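(* Let $(X,d)$ be a geodesic metric space with basepoint $o$, and let $G$ be a countable group of isometries of $X$ containing two independent contracting isometries. Let $\mu$ be a non-elementary probability measure on $G$ with finite first moment. Then there exist $C,\epsilon>0$ such that \[ |l(\mu')-l(\mu)| \le C\,\|\mu'-\mu\|_{0,1} \] for every probability measure $\mu'$ on $G$ with $\|\mu'-\mu\|_{0,1}<\epsilon$.
   Context: For a closed set $A\subseteq X$, $\pi_A$ denotes closest point projection onto $A$. A $K$-quasigeodesic $\gamma$ is a $K$-contracting axis if $\operatorname{diam}(\pi_\gamma(\eta))<K$ for every geodesic $\eta$ not entering the $K$-neighborhood of $\gamma$. An isometry $g$ is contracting if its orbit $\{g^i o\}_{i\in\mathbb Z}$ is a $K$-contracting axis for some $K$; two contracting isometries are independent if their orbits have bounded projections onto each other. A probability measure $\mu$ on $G$ is non-elementary if the semigroup generated by its support contains two independent contracting isometries. For $g\in G$ write $\|g\|=d(o,go)$. For a signed measure $\eta$ on $G$: $\|\eta\|_0=\sum_g|\eta(g)|$, $\|\eta\|_1=\sum_g d(o,go)|\eta(g)|$, $\|\eta\|_{0,1}=\|\eta\|_0+\|\eta\|_1$. $\mu$ has finite first moment if $\|\mu\|_1<\infty$. With $L(\mu)=\sum_g\mu(g)d(o,go)$, the escape rate is $l(\mu)=\lim_{n\to\infty}L(\mu^{*n})/n$, where $\mu^{*n}$ is the $n$-fold convolution. *)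

theory Defs
  imports "HOL-Probability.Probability"
begin

definition geodesic_space :: "'a::metric_space itself \<Rightarrow> bool" where
  "geodesic_space _ \<longleftrightarrow>
     (\<forall>x y::'a. \<exists>\<gamma>::real \<Rightarrow> 'a. \<gamma> 0 = x \<and> \<gamma> (dist x y) = y \<and>
        (\<forall>s\<in>{0..dist x y}. \<forall>t\<in>{0..dist x y}. dist (\<gamma> s) (\<gamma> t) = \<bar>s - t\<bar>))"

definition geodesic_segment :: "'a::metric_space set \<Rightarrow> bool" where
  "geodesic_segment S \<longleftrightarrow>
     (\<exists>a b (\<gamma>::real \<Rightarrow> 'a). a \<le> b \<and>
        (\<forall>s\<in>{a..b}. \<forall>t\<in>{a..b}. dist (\<gamma> s) (\<gamma> t) = \<bar>s - t\<bar>) \<and> S = \<gamma> ` {a..b})"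

definition proj :: "'a::metric_space set \<Rightarrow> 'a \<Rightarrow> 'a set" where
  "proj A x = {a \<in> A. dist x a = infdist x A}"

definition proj_set :: "'a::metric_space set \<Rightarrow> 'a set \<Rightarrow> 'a set" where
  "proj_set A S = (\<Union>x\<in>S. proj A x)"

definition quasigeodesic :: "real \<Rightarrow> (int \<Rightarrow> 'a::metric_space) \<Rightarrow> bool" where
  "quasigeodesic K f \<longleftrightarrow>
     (\<forall>i j. \<bar>real_of_int (i - j)\<bar> / K - K \<le> dist (f i) (f j) \<and>
            dist (f i) (f j) \<le> K * \<bar>real_of_int (i - j)\<bar> + K)"

definition contracting_axis :: "real \<Rightarrow> (int \<Rightarrow> 'a::metric_space) \<Rightarrow> bool" where
  "contracting_axis K f \<longleftrightarrow> quasigeodesic K f \<and>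
     (\<forall>\<eta>. geodesic_segment \<eta> \<longrightarrow> (\<forall>y\<in>\<eta>. K \<le> infdist y (range f)) \<longrightarrow>
        bounded (proj_set (range f) \<eta>) \<and> diameter (proj_set (range f) \<eta>) < K)"

definition isometry :: "('a::metric_space \<Rightarrow> 'a) \<Rightarrow> bool" where
  "isometry g \<longleftrightarrow> bij g \<and> (\<forall>x y. dist (g x) (g y) = dist x y)"

definition isometry_group :: "('a::metric_space \<Rightarrow> 'a) set \<Rightarrow> bool" where
  "isometry_group G \<longleftrightarrow> (\<forall>g\<in>G. isometry g) \<and> id \<in> G \<and>
     (\<forall>g\<in>G. \<forall>h\<in>G. g \<circ> h \<in> G) \<and> (\<forall>g\<in>G. inv g \<in> G)"

definition zpow :: "('a \<Rightarrow> 'a) \<Rightarrow> int \<Rightarrow> ('a \<Rightarrow> 'a)" where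
  "zpow g i = (if 0 \<le> i then g ^^ nat i else inv g ^^ nat (- i))"

definition orbit_map :: "'a \<Rightarrow> ('a \<Rightarrow> 'a) \<Rightarrow> int \<Rightarrow> 'a" where
  "orbit_map bp g = (\<lambda>i. zpow g i bp)"

definition contracting :: "'a::metric_space \<Rightarrow> ('a \<Rightarrow> 'a) \<Rightarrow> bool" where
  "contracting bp g \<longleftrightarrow> (\<exists>K>0. contracting_axis K (orbit_map bp g))"

definition independent :: "'a::metric_space \<Rightarrow> ('a \<Rightarrow> 'a) \<Rightarrow> ('a \<Rightarrow> 'a) \<Rightarrow> bool" where
  "independent bp g h \<longleftrightarrow> contracting bp g \<and> contracting bp h \<and>
     bounded (proj_set (range (orbit_map bp g)) (range (orbit_map bp h))) \<and>
     bounded (proj_set (range (orbit_map bp h)) (range (orbit_map bp g)))"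

inductive_set semigroup_gen :: "('a \<Rightarrow> 'a) set \<Rightarrow> ('a \<Rightarrow> 'a) set" for S where
  base: "g \<in> S \<Longrightarrow> g \<in> semigroup_gen S"
| comp: "g \<in> semigroup_gen S \<Longrightarrow> h \<in> semigroup_gen S \<Longrightarrow> g \<circ> h \<in> semigroup_gen S"

definition non_elementary :: "'a::metric_space \<Rightarrow> ('a \<Rightarrow> 'a) pmf \<Rightarrow> bool" where
  "non_elementary bp \<mu> \<longleftrightarrow>
     (\<exists>g\<in>semigroup_gen (set_pmf \<mu>). \<exists>h\<in>semigroup_gen (set_pmf \<mu>). independent bp g h)"

definition word_norm :: "'a::metric_space \<Rightarrow> ('a \<Rightarrow> 'a) \<Rightarrow> real" where
  "word_norm bp g = dist bp (g bp)"

definition finite_first_moment :: "'a::metric_space \<Rightarrow> ('a \<Rightarrow> 'a) pmf \<Rightarrow> bool" where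
  "finite_first_moment bp \<mu> \<longleftrightarrow> (\<lambda>g. word_norm bp g * pmf \<mu> g) summable_on UNIV"

primrec conv_pow :: "('a \<Rightarrow> 'a) pmf \<Rightarrow> nat \<Rightarrow> ('a \<Rightarrow> 'a) pmf" where
  "conv_pow \<mu> 0 = return_pmf id"
| "conv_pow \<mu> (Suc n) = bind_pmf (conv_pow \<mu> n) (\<lambda>g. map_pmf (\<lambda>h. g \<circ> h) \<mu>)"

definition L_mean :: "'a::metric_space \<Rightarrow> ('a \<Rightarrow> 'a) pmf \<Rightarrow> real" where
  "L_mean bp \<mu> = (\<Sum>\<^sub>\<infinity>g. pmf \<mu> g * word_norm bp g)"

definition escape_rate :: "'a::metric_space \<Rightarrow> ('a \<Rightarrow> 'a) pmf \<Rightarrow> real" where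
  "escape_rate bp \<mu> = lim (\<lambda>n. L_mean bp (conv_pow \<mu> n) / real n)"

text \<open>Norms of signed measures on G (given as real functions).\<close>
definition norm0 :: "(('a \<Rightarrow> 'a) \<Rightarrow> real) \<Rightarrow> real" where
  "norm0 \<eta> = (\<Sum>\<^sub>\<infinity>g. \<bar>\<eta> g\<bar>)"

definition norm1 :: "'a::metric_space \<Rightarrow> (('a \<Rightarrow> 'a) \<Rightarrow> real) \<Rightarrow> real" where
  "norm1 bp \<eta> = (\<Sum>\<^sub>\<infinity>g. word_norm bp g * \<bar>\<eta> g\<bar>)"

definition norm01 :: "'a::metric_space \<Rightarrow> (('a \<Rightarrow> 'a) \<Rightarrow> real) \<Rightarrow> real" where
  "norm01 bp \<eta> = norm0 \<eta> + norm1 bp \<eta>"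

definition finite_norm01 :: "'a::metric_space \<Rightarrow> (('a \<Rightarrow> 'a) \<Rightarrow> real) \<Rightarrow> bool" where
  "finite_norm01 bp \<eta> \<longleftrightarrow> (\<lambda>g. \<bar>\<eta> g\<bar>) summable_on UNIV \<and>
      (\<lambda>g. word_norm bp g * \<bar>\<eta> g\<bar>) summable_on UNIV"

end

theory Submission
  imports Defs
begin

text \<open>
  Write \<open>o\<close> for the base point and \<open>D x y = d(x,o) + d(o,y) - d(x,y)\<close>. The point is that
  \<open>D x (v o)\<close> has bounded expectation for \<open>v\<close> distributed as \<open>\<mu>\<^sup>*\<^sup>n\<close>, uniformly in \<open>x\<close> and \<open>n\<close>.
  Granting this, write \<open>\<mu>'\<^sup>*\<^sup>n - \<mu>\<^sup>*\<^sup>n\<close> as the telescoping sum of the convolutions of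
  \<open>\<mu>'\<^sup>*\<^sup>k\<close>, \<open>\<mu>' - \<mu>\<close> and \<open>\<mu>\<^sup>*\<^sup>n\<^sup>-\<^sup>k\<^sup>-\<^sup>1\<close>. Since \<open>\<mu>' - \<mu>\<close> has total mass zero, each term changes \<open>L\<close> by at
  most a constant times \<open>\<parallel>\<mu>' - \<mu>\<parallel>\<^sub>0\<^sub>,\<^sub>1\<close>, so only \<open>\<mu>\<close> has to be non-elementary.

  For the uniform bound cut the walk into blocks. A block spelling a word in large powers of the two
  contracting isometries is left-good for almost all words given the past, and right-good for almost
  all words given the future; a block that is both satisfies \<open>D x (s y) \<le> C\<close> for the past \<open>x\<close> and
  the future \<open>y\<close>. The increments before the first good block therefore have bounded expected total
  length: badness on the left is controlled by revealing the blocks forwards, badness on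
  the right by revealing them backwards, and the two are decoupled by the arithmetic-geometric mean
  inequality. Conditioning on a single long increment does not affect these estimates, which is why a
  first moment suffices.
\<close>

section \<open>Projections to contracting axes\<close>

lemma mem_proj_iff:
  assumes "A \<noteq> {}"
  shows "a \<in> proj A x \<longleftrightarrow> a \<in> A \<and> (\<forall>b\<in>A. dist x a \<le> dist x b)"
proof
  assume "a \<in> proj A x"
  then show "a \<in> A \<and> (\<forall>b\<in>A. dist x a \<le> dist x b)"
    by (auto simp: proj_def intro: infdist_le)
next
  assume a: "a \<in> A \<and> (\<forall>b\<in>A. dist x a \<le> dist x b)"
  then have "dist x a \<le> infdist x A"
    using assms by (simp add: infdist_notempty cINF_greatest)
  with a show "a \<in> proj A x"
    by (auto simp: proj_def intro!: antisym infdist_le)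
qed

text \<open>The lower quasigeodesic bound leaves only finitely many indices whose points are no
  farther from \<open>x\<close> than \<open>f 0\<close>, so the distance attains its
  minimum.\<close>

lemma quasigeodesic_proj_nonempty:
  assumes "quasigeodesic K f" and "K > 0"
  shows "proj (range f) x \<noteq> {}"
proof -
  define J where "J = {i. dist x (f i) \<le> dist x (f 0)}"
  define B where "B = \<lceil>K * (2 * dist x (f 0) + K)\<rceil>"
  have "J \<subseteq> {-B..B}"
  proof
    fix i assume "i \<in> J"
    then have "dist (f i) (f 0) \<le> 2 * dist x (f 0)"
      using dist_triangle3[of "f i" "f 0" x] by (simp add: J_def)
    moreover have "\<bar>real_of_int i\<bar> / K - K \<le> dist (f i) (f 0)"
      using assms(1) unfolding quasigeodesic_def by (metis diff_zero)
    ultimately have "\<bar>real_of_int i\<bar> / K \<le> 2 * dist x (f 0) + K" by linarith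
    then have "\<bar>real_of_int i\<bar> \<le> K * (2 * dist x (f 0) + K)"
      using assms(2) by (simp add: field_simps)
    then have "\<bar>real_of_int i\<bar> \<le> of_int B" unfolding B_def by linarith
    then show "i \<in> {-B..B}" by auto
  qed
  then have fin: "finite J" by (rule finite_subset) auto
  have "0 \<in> J" by (simp add: J_def)
  with fin obtain i where i: "i \<in> J" "\<And>j. j \<in> J \<Longrightarrow> dist x (f i) \<le> dist x (f j)"
    using ex_min_if_finite[of "(\<lambda>i. dist x (f i)) ` J"] by (force simp: not_less)
  have "dist x (f i) \<le> dist x (f j)" for j
    using i(2)[OF \<open>0 \<in> J\<close>] i(2)[of j] by (cases "j \<in> J") (auto simp: J_def)
  then have "f i \<in> proj (range f) x" by (subst mem_proj_iff) auto
  then show ?thesis by blast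
qed

text \<open>Before its first entrance into the closed \<open>K\<close>-neighbourhood the geodesic
  stays outside, so the projections of this initial piece have diameter below \<open>K\<close>. The
  entrance point is within \<open>K\<close> of its own projection, whence
  \<open>2 * K\<close>.\<close>

lemma contracting_first_entrance:
  assumes ca: "contracting_axis K f" and K: "K > 0"
    and geo: "\<forall>s\<in>{0..T}. \<forall>t\<in>{0..T}. dist (\<gamma> s) (\<gamma> t) = \<bar>s - t\<bar>"
    and p: "p \<in> proj (range f) (\<gamma> 0)"
    and enter: "t0 \<in> {0..T}" "infdist (\<gamma> t0) (range f) \<le> K"
  obtains t1 where "t1 \<in> {0..T}" "dist p (\<gamma> t1) \<le> 2 * K"
    "\<And>t. t \<in> {0..T} \<Longrightarrow> infdist (\<gamma> t) (range f) \<le> K \<Longrightarrow> t1 \<le> t"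
proof -
  have qg: "quasigeodesic K f" using ca by (simp add: contracting_axis_def)
  define A where "A = range f"
  define d where "d = (\<lambda>t. infdist (\<gamma> t) A)"
  have lip: "\<bar>d s - d t\<bar> \<le> \<bar>s - t\<bar>" if "s \<in> {0..T}" "t \<in> {0..T}" for s t
    using infdist_triangle_abs[of "\<gamma> s" A "\<gamma> t"] geo that by (simp add: d_def)
  have cont: "continuous_on {0..T} d"
    unfolding continuous_on_iff
  proof (intro ballI allI impI)
    fix x e :: real assume "x \<in> {0..T}" "0 < e"
    then have "dist (d x') (d x) < e" if "x' \<in> {0..T}" "dist x' x < e" for x'
      using lip[of x' x] that by (auto simp: dist_real_def)
    with \<open>0 < e\<close> show "\<exists>r>0. \<forall>x'\<in>{0..T}. dist x' x < r \<longrightarrow> dist (d x') (d x) < e"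
      by blast
  qed
  define Z where "Z = {t \<in> {0..T}. d t \<le> K}"
  have "compact Z"
  proof -
    have "Z = {0..T} \<inter> d -` {..K}" by (auto simp: Z_def)
    then have "closed Z"
      using cont by (simp add: continuous_closed_preimage)
    moreover have "bounded Z"
      by (rule bounded_subset[of "{0..T}"]) (auto simp: Z_def)
    ultimately show ?thesis by (simp add: compact_eq_bounded_closed)
  qed
  moreover have "t0 \<in> Z" using enter by (simp add: Z_def d_def A_def)
  ultimately obtain t1 where t1: "t1 \<in> Z" "\<And>t. t \<in> Z \<Longrightarrow> t1 \<le> t"
    using compact_attains_inf[of Z] by blast
  have t1T: "0 \<le> t1" "t1 \<le> T" "d t1 \<le> K" using t1(1) by (auto simp: Z_def)
  have "dist p (\<gamma> t1) \<le> 2 * K"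
  proof (cases "t1 = 0")
    case True
    have "dist (\<gamma> 0) p = d 0" using p by (simp add: proj_def d_def A_def)
    then show ?thesis using True t1T K by (simp add: dist_commute)
  next
    case False
    have lt: "d t > K" if "0 \<le> t" "t < t1" for t
      using t1(2)[of t] that t1T by (force simp: Z_def)
    \<comment> \<open>Contraction is stated for closed segments, so the end point \<open>t1\<close>
      must satisfy the lower bound too; the Lipschitz estimate for \<open>d\<close> supplies
      it.\<close>
    have "d t1 \<ge> K"
    proof (rule ccontr)
      assume neg: "\<not> K \<le> d t1"
      define e where "e = min t1 (K - d t1)"
      have e: "e > 0" "e \<le> t1" "e \<le> K - d t1" using neg False t1T by (auto simp: e_def)
      have "\<bar>d (t1 - e/2) - d t1\<bar> \<le> e/2" using lip[of "t1 - e/2" t1] e t1T by simp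
      then have "d (t1 - e/2) \<le> d t1 + e/2" by linarith
      moreover have "d (t1 - e/2) > K" using lt[of "t1 - e/2"] e by auto
      ultimately show False using e by linarith
    qed
    have ge: "K \<le> infdist y (range f)" if "y \<in> \<gamma> ` {0..t1}" for y
      using that lt \<open>d t1 \<ge> K\<close> by (force simp: d_def A_def le_less)
    have "geodesic_segment (\<gamma> ` {0..t1})"
      unfolding geodesic_segment_def using geo t1T by (intro exI[of _ 0] exI[of _ t1] exI[of _ \<gamma>]) auto
    then have bd: "bounded (proj_set (range f) (\<gamma> ` {0..t1}))"
      and dm: "diameter (proj_set (range f) (\<gamma> ` {0..t1})) < K"
      using ca ge unfolding contracting_axis_def by blast+
    obtain p1 where p1: "p1 \<in> proj (range f) (\<gamma> t1)"
      using quasigeodesic_proj_nonempty[OF qg K] by blast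
    have "p \<in> proj_set (range f) (\<gamma> ` {0..t1})" "p1 \<in> proj_set (range f) (\<gamma> ` {0..t1})"
      using p p1 t1T by (auto simp: proj_set_def)
    then have "dist p p1 \<le> K" using diameter_bounded_bound[OF bd] dm by fastforce
    moreover have "dist (\<gamma> t1) p1 \<le> K" using p1 t1T by (simp add: proj_def d_def A_def)
    ultimately show ?thesis using dist_triangle2[of p "\<gamma> t1" p1] by linarith
  qed
  with t1 t1T that show ?thesis unfolding Z_def d_def A_def by auto
qed

text \<open>A form of contraction that mentions no geodesics: if two projections are more than
  \<open>C\<close> apart, the detour from \<open>x\<close> to \<open>y\<close> through them is
  shortest up to \<open>C\<close>.\<close>

definition proj_controlled :: "real \<Rightarrow> 'a::metric_space set \<Rightarrow> bool" where
  "proj_controlled C A \<longleftrightarrow> (\<forall>x. proj A x \<noteq> {}) \<and>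
     (\<forall>x y. \<forall>p\<in>proj A x. \<forall>q\<in>proj A y.
        dist p q \<le> C \<or> dist x p + dist p q + dist q y - C \<le> dist x y)"

lemma proj_controlled_mono:
  assumes "proj_controlled C A" "C \<le> C'" shows "proj_controlled C' A"
proof -
  have "dist p q \<le> C' \<or> dist x p + dist p q + dist q y - C' \<le> dist x y"
    if "p \<in> proj A x" "q \<in> proj A y" for x y p q
  proof -
    have "dist p q \<le> C \<or> dist x p + dist p q + dist q y - C \<le> dist x y"
      using assms(1) that unfolding proj_controlled_def by blast
    then show ?thesis using assms(2) by linarith
  qed
  then show ?thesis using assms(1) unfolding proj_controlled_def by blast
qed

lemma proj_controlledD:
  assumes "proj_controlled C A" "p \<in> proj A x" "q \<in> proj A y" "C < dist p q"
  shows "dist x p + dist p q + dist q y - C \<le> dist x y"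
  using assms unfolding proj_controlled_def by force

text \<open>The points of first entrance seen from \<open>x\<close> and from \<open>y\<close> are
  within \<open>2 * K\<close> of \<open>p\<close> and \<open>q\<close>. The detour through
  \<open>p\<close> and \<open>q\<close> costs \<open>2 * K\<close> at either end and
  \<open>4 * K\<close> in between, \<open>8 * K\<close> in all.\<close>

lemma contracting_axis_proj_controlled:
  fixes f :: "int \<Rightarrow> 'a::metric_space"
  assumes gs: "geodesic_space TYPE('a)" and ca: "contracting_axis K f" and K: "K > 0"
  shows "proj_controlled (8 * K) (range f)"
  unfolding proj_controlled_def
proof (intro conjI allI ballI)
  have qg: "quasigeodesic K f" using ca by (simp add: contracting_axis_def)
  show "proj (range f) x \<noteq> {}" for x by (rule quasigeodesic_proj_nonempty[OF qg K])
  fix x y p q assume p: "p \<in> proj (range f) x" and q: "q \<in> proj (range f) y"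
  define T where "T = dist x y"
  obtain \<gamma> where \<gamma>: "\<gamma> 0 = x" "\<gamma> T = y"
      and geo: "\<forall>s\<in>{0..T}. \<forall>t\<in>{0..T}. dist (\<gamma> s) (\<gamma> t) = \<bar>s - t\<bar>"
    using gs unfolding geodesic_space_def T_def by blast
  have T: "T \<ge> 0" by (simp add: T_def)
  show "dist p q \<le> 8 * K \<or> dist x p + dist p q + dist q y - 8 * K \<le> dist x y"
  proof (cases "\<forall>t\<in>{0..T}. K \<le> infdist (\<gamma> t) (range f)")
    case True
    have "geodesic_segment (\<gamma> ` {0..T})"
      unfolding geodesic_segment_def using geo T by (intro exI[of _ 0] exI[of _ T] exI[of _ \<gamma>]) auto
    then have bd: "bounded (proj_set (range f) (\<gamma> ` {0..T}))"
      and dm: "diameter (proj_set (range f) (\<gamma> ` {0..T})) < K"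
      using ca True unfolding contracting_axis_def by blast+
    have "p \<in> proj_set (range f) (\<gamma> ` {0..T})" "q \<in> proj_set (range f) (\<gamma> ` {0..T})"
      using p q \<gamma> T by (auto simp: proj_set_def)
    then have "dist p q \<le> K" using diameter_bounded_bound[OF bd] dm by fastforce
    then show ?thesis using K by simp
  next
    case False
    then obtain t0 where t0: "t0 \<in> {0..T}" "infdist (\<gamma> t0) (range f) \<le> K" by force
    obtain t1 where t1: "t1 \<in> {0..T}" "dist p (\<gamma> t1) \<le> 2 * K"
      "\<And>t. t \<in> {0..T} \<Longrightarrow> infdist (\<gamma> t) (range f) \<le> K \<Longrightarrow> t1 \<le> t"
      using contracting_first_entrance[OF ca K geo _ t0] p \<gamma> by blast
    have geo': "\<forall>s\<in>{0..T}. \<forall>t\<in>{0..T}. dist (\<gamma> (T - s)) (\<gamma> (T - t)) = \<bar>s - t\<bar>"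
      using geo by auto
    obtain t2 where t2: "t2 \<in> {0..T}" "dist q (\<gamma> (T - t2)) \<le> 2 * K"
      "\<And>t. t \<in> {0..T} \<Longrightarrow> infdist (\<gamma> (T - t)) (range f) \<le> K \<Longrightarrow> t2 \<le> t"
      using contracting_first_entrance[where \<gamma> = "\<lambda>t. \<gamma> (T - t)" and ?t0.0 = "T - t0", OF ca K geo'] q \<gamma> t0
      by auto
    \<comment> \<open>The time \<open>t0\<close> lies in the neighbourhood, so it separates the
      entrance seen from \<open>x\<close> from the one seen from \<open>y\<close>.\<close>
    have "t1 \<le> t0" using t1(3) t0 by blast
    moreover have "t2 \<le> T - t0" using t2(3)[of "T - t0"] t0 by auto
    ultimately have le: "t1 \<le> T - t2" by linarith
    have 1: "dist x (\<gamma> t1) = t1" using geo t1(1) T \<gamma>(1) by fastforce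
    have 2: "dist (\<gamma> (T - t2)) y = t2" using geo t2(1) T \<gamma>(2) by force
    have 3: "dist (\<gamma> t1) (\<gamma> (T - t2)) = T - t2 - t1"
      using geo t1(1) t2(1) le by auto
    have "dist x p \<le> t1 + 2 * K" using 1 t1(2) dist_triangle2[of x p "\<gamma> t1"] by linarith
    moreover have "dist q y \<le> t2 + 2 * K" using 2 t2(2) dist_triangle[of q y "\<gamma> (T - t2)"] by linarith
    moreover have "dist p q \<le> T - t2 - t1 + 4 * K"
      using 3 t1(2) t2(2) dist_triangle[of p q "\<gamma> t1"] dist_triangle2[of "\<gamma> t1" q "\<gamma> (T - t2)"] by linarith
    ultimately show ?thesis by (simp add: T_def)
  qed
qed

text \<open>If both projections were far from \<open>z\<close>, the way from \<open>x\<close> to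
  \<open>q\<close> would pass near \<open>p\<close>, and the way from \<open>x\<close> to
  \<open>p\<close> near \<open>q\<close>. In the sum of the two inequalities \<open>dist x p\<close>
  and \<open>dist x q\<close> cancel, and a quantity above \<open>4 * C\<close> would be at most
  \<open>2 * C\<close>.\<close>

lemma behrstock_inequality:
  assumes A: "proj_controlled C A" and B: "proj_controlled C B" and C: "C \<ge> 0"
    and AB: "proj_set A B \<subseteq> cball z R" and BA: "proj_set B A \<subseteq> cball z R"
    and p: "p \<in> proj A x" and q: "q \<in> proj B x"
  shows "dist z p \<le> R + 2 * C \<or> dist z q \<le> R + 2 * C"
proof (rule ccontr)
  assume far: "\<not> ?thesis"
  obtain p' q' where p': "p' \<in> proj A q" and q': "q' \<in> proj B p"
    using A B unfolding proj_controlled_def by blast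
  have "dist z p' \<le> R" "dist z q' \<le> R"
    using AB BA p q p' q' unfolding proj_set_def proj_def by (auto simp: subset_iff)
  then have "dist p p' > 2 * C" "dist q q' > 2 * C"
    using far dist_triangle2[of z p p'] dist_triangle2[of z q q'] by linarith+
  moreover have "dist x p + dist p p' + dist p' q - C \<le> dist x q"
    using \<open>dist p p' > 2 * C\<close> C by (intro proj_controlledD[OF A p p']) linarith
  moreover have "dist x q + dist q q' + dist q' p - C \<le> dist x p"
    using \<open>dist q q' > 2 * C\<close> C by (intro proj_controlledD[OF B q q']) linarith
  ultimately show False using C zero_le_dist[of p' q] zero_le_dist[of q' p] by linarith
qed

section \<open>Words in two independent contracting isometries\<close>

lemma isometry_dist: "isometry g \<Longrightarrow> dist (g x) (g y) = dist x y"
  by (simp add: isometry_def)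

lemma isometry_inv:
  assumes "isometry g" shows "isometry (inv g)"
  using assms unfolding isometry_def by (metis bij_imp_bij_inv bij_inv_eq_iff)

lemma isometry_comp: "isometry g \<Longrightarrow> isometry h \<Longrightarrow> isometry (g \<circ> h)"
  by (auto simp: isometry_def bij_comp)

lemma isometry_id: "isometry id"
  by (simp add: isometry_def)

lemma isometry_dist_inv:
  assumes "isometry g" shows "dist (inv g x) y = dist x (g y)"
  using assms unfolding isometry_def by (metis bij_inv_eq_iff)

lemma isometry_funpow: "isometry g \<Longrightarrow> isometry (g ^^ n)"
  by (induction n) (simp_all add: isometry_id[unfolded id_def] isometry_id isometry_comp)

lemma isometry_zpow: "isometry g \<Longrightarrow> isometry (zpow g i)"
  by (simp add: zpow_def isometry_funpow isometry_inv)

lemma zpow_succ: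
  assumes "bij g" shows "zpow g (i + 1) = g \<circ> zpow g i"
proof (cases "0 \<le> i")
  case True
  then have "nat (i + 1) = Suc (nat i)" by simp
  with True show ?thesis by (simp add: zpow_def)
next
  case False
  then have "nat (- i) = Suc (nat (- (i + 1)))" by simp
  moreover have "g \<circ> inv g = id" using assms by (metis bij_is_surj surj_iff)
  ultimately have "g \<circ> zpow g i = inv g ^^ nat (- (i + 1))"
    using False by (simp add: zpow_def fun_eq_iff)
  also have "\<dots> = zpow g (i + 1)"
  proof (cases "i = -1")
    case True then show ?thesis by (simp add: zpow_def)
  next
    case f: False then show ?thesis using False by (simp add: zpow_def)
  qed
  finally show ?thesis by simp
qed

lemma zpow_add:
  assumes "bij g" shows "zpow g (i + j) = zpow g i \<circ> zpow g j"
proof (induction i rule: int_induct[where k = 0])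
  case base then show ?case by (simp add: zpow_def)
next
  case (step1 i)
  have "zpow g (i + 1 + j) = zpow g ((i + j) + 1)" by (simp add: ac_simps)
  then show ?case using step1 zpow_succ[OF assms] by (simp add: comp_assoc)
next
  case (step2 i)
  have "g \<circ> zpow g (i - 1 + j) = zpow g (i + j)"
    using zpow_succ[OF assms, of "i - 1 + j"] by simp
  also have "\<dots> = g \<circ> (zpow g (i - 1) \<circ> zpow g j)"
    using step2.IH zpow_succ[OF assms, of "i - 1"] by (simp add: fun_eq_iff)
  finally show ?case using assms by (simp add: bij_is_inj inj_eq fun_eq_iff)
qed

text \<open>Turns the action of a letter into a translation of projection indices.\<close>

lemma mem_proj_orbit_shift:
  assumes g: "isometry g"
  shows "orbit_map z g (i + n) \<in> proj (range (orbit_map z g)) (zpow g n x) \<longleftrightarrow>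
         orbit_map z g i \<in> proj (range (orbit_map z g)) x"
proof -
  have b: "bij g" using g by (simp add: isometry_def)
  have o: "dist (zpow g n x) (orbit_map z g (j + n)) = dist x (orbit_map z g j)" for j
    using zpow_add[OF b, of n j] isometry_dist[OF isometry_zpow[OF g]]
    by (simp add: orbit_map_def add.commute)
  have "(\<forall>j. dist x (orbit_map z g i) \<le> dist (zpow g n x) (orbit_map z g j)) \<longleftrightarrow>
        (\<forall>j. dist x (orbit_map z g i) \<le> dist x (orbit_map z g j))"
    using o by (metis add.commute diff_add_cancel)
  then show ?thesis by (simp add: mem_proj_iff o)
qed

text \<open>Each state satisfies \<open>W\<close> for some \<open>c0\<close>. Reading
  \<open>c0\<close> makes \<open>W\<close> hold for both values of \<open>c\<close>, and this
  persists. A bad word must therefore read the other letter every time, which determines it.\<close>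

lemma card_bad_words_le_1:
  fixes T :: "bool \<Rightarrow> 'a \<Rightarrow> 'a" and W :: "nat \<Rightarrow> bool \<Rightarrow> 'a \<Rightarrow> bool"
  assumes start: "\<And>x. \<exists>c. W 0 c x"
    and step: "\<And>k c c' x. W k c x \<Longrightarrow> W (Suc k) c' (T c x)"
    and mono: "\<And>k c x. W k c x \<Longrightarrow> W (Suc k) c x"
  shows "card {bs. length bs = n \<and> \<not> (\<forall>c. W n c (fold T bs x))} \<le> 1"
proof (induction n arbitrary: x)
  case 0
  have "{bs::bool list. length bs = 0 \<and> \<not> (\<forall>c. W 0 c (fold T bs x))} \<subseteq> {[]}" by auto
  from card_mono[OF _ this] show ?case by simp
next
  case (Suc n)
  have all: "W (k + length bs) c (fold T bs y)" if "\<And>c. W k c y" for k bs c y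
    using that
  proof (induction bs arbitrary: k y)
    case (Cons b bs)
    have "W (Suc k) c (T b y)" for c using Cons.prems step by blast
    from Cons.IH[OF this] show ?case by simp
  qed auto
  obtain c0 where c0: "W 0 c0 x" using start by blast
  define B where "B = {bs. length bs = n \<and> \<not> (\<forall>c. W n c (fold T bs (T (\<not> c0) x)))}"
  have "{bs. length bs = Suc n \<and> \<not> (\<forall>c. W (Suc n) c (fold T bs x))} \<subseteq> (\<lambda>bs. (\<not> c0) # bs) ` B"
  proof
    fix bs assume "bs \<in> {bs. length bs = Suc n \<and> \<not> (\<forall>c. W (Suc n) c (fold T bs x))}"
    then obtain b bs' where bs: "bs = b # bs'" "length bs' = n"
      and bad: "\<not> (\<forall>c. W (Suc n) c (fold T bs' (T b x)))"
      by (cases bs) auto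
    have "b \<noteq> c0"
    proof
      assume "b = c0"
      have "W (1 + length bs') c (fold T bs' (T c0 x))" for c
        by (rule all) (use step[OF c0] in simp)
      with bad \<open>b = c0\<close> bs(2) show False by simp
    qed
    then have "b = (\<not> c0)" by auto
    \<comment> \<open>The tail is judged from a fresh start, with index \<open>n\<close> in place of
      \<open>Suc n\<close>; \<open>mono\<close> bridges the difference.\<close>
    moreover have "bs' \<in> B" using bad mono bs(2) \<open>b = (\<not> c0)\<close> unfolding B_def by blast
    ultimately show "bs \<in> (\<lambda>bs. (\<not> c0) # bs) ` B" using bs by blast
  qed
  moreover have "finite B"
    by (rule finite_subset[OF _ finite_lists_length_eq[of UNIV n]]) (auto simp: B_def)
  ultimately have "card {bs. length bs = Suc n \<and> \<not> (\<forall>c. W (Suc n) c (fold T bs x))} \<le> card B"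
    by (meson card_image_le card_mono finite_imageI order_trans)
  with Suc.IH[of "T (\<not> c0) x"] show ?case unfolding B_def by linarith
qed

text \<open>The isometries are \<open>f True\<close> and \<open>f False\<close>, to be raised to the
  powers \<open>e\<close>. Orbit points within \<open>R\<close> of \<open>z\<close> have indices in
  \<open>{-i0..i0}\<close>; an exponent above \<open>2 * i0\<close> moves this window off itself,
  and by \<open>separation\<close> what remains of the exponent still covers more than
  \<open>C\<close> along the axis of \<open>f True\<close>.\<close>

locale schottky_pair =
  fixes z :: "'a::metric_space" and f :: "bool \<Rightarrow> 'a \<Rightarrow> 'a" and e :: "bool \<Rightarrow> int"
    and C R :: real and i0 m :: int
  assumes iso: "isometry (f c)"
    and ctl: "proj_controlled C (range (orbit_map z (f c)))"
    and behr: "p \<in> proj (range (orbit_map z (f c))) x \<Longrightarrow>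
      q \<in> proj (range (orbit_map z (f (\<not> c)))) x \<Longrightarrow> dist z p \<le> R \<or> dist z q \<le> R"
    and index_bound: "dist z (orbit_map z (f c) i) \<le> R \<Longrightarrow> \<bar>i\<bar> \<le> i0"
    and e_bounds: "2 * i0 < e c" "e c \<le> m" and i0: "0 \<le> i0"
    and separation: "e True - 2 * i0 \<le> j - i \<Longrightarrow>
      C < dist (orbit_map z (f True) i) (orbit_map z (f True) j)"
begin

definition axis :: "bool \<Rightarrow> 'a set" where "axis c = range (orbit_map z (f c))"

text \<open>
  The sign \<open>\<sigma>\<close> is \<open>1\<close> for points reached by the past of a word and \<open>-1\<close> for points reached by its
  future. The upper bound says that the projection of \<open>x\<close> does not lie ahead; the lower bound keeps it
  at bounded distance from the base point after \<open>k\<close> letters.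
\<close>

definition facing :: "int \<Rightarrow> nat \<Rightarrow> bool \<Rightarrow> 'a \<Rightarrow> bool" where
  "facing \<sigma> k c x \<longleftrightarrow> (\<forall>i. orbit_map z (f c) i \<in> proj (axis c) x \<longrightarrow>
      - i0 - int k * m \<le> \<sigma> * i \<and> \<sigma> * i \<le> i0)"

definition letter :: "bool \<Rightarrow> 'a \<Rightarrow> 'a" where "letter c = zpow (f c) (e c)"

text \<open>Reading a letter moves a past point by the inverse of the letter and a future point by
  the letter itself; \<open>\<sigma>\<close> selects the case, so that one argument serves both
  directions.\<close>

definition shift :: "int \<Rightarrow> bool \<Rightarrow> 'a \<Rightarrow> 'a" where "shift \<sigma> c = zpow (f c) (- \<sigma> * e c)"

lemma m_pos: "0 \<le> m" using e_bounds[of True] i0 by linarith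

lemma ex_proj: obtains i where "orbit_map z (f c) i \<in> proj (axis c) x"
  using ctl[of c] unfolding proj_controlled_def axis_def proj_def by blast

text \<open>A projection with index beyond \<open>i0\<close> is farther than \<open>R\<close> from
  \<open>z\<close>, so \<open>behr\<close> puts the projection to the other axis near
  \<open>z\<close>.\<close>

lemma facing_of_far:
  assumes \<sigma>: "\<sigma> = 1 \<or> \<sigma> = -1" and i: "orbit_map z (f c) i \<in> proj (axis c) x" "i0 < \<bar>i\<bar>"
  shows "facing \<sigma> k (\<not> c) x"
  unfolding facing_def
proof (intro allI impI)
  fix j assume j: "orbit_map z (f (\<not> c)) j \<in> proj (axis (\<not> c)) x"
  have "\<not> dist z (orbit_map z (f c) i) \<le> R" using index_bound[of c i] i(2) by linarith
  then have "dist z (orbit_map z (f (\<not> c)) j) \<le> R" using behr i(1) j unfolding axis_def by blast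
  then have "\<bar>j\<bar> \<le> i0" by (rule index_bound)
  moreover have "0 \<le> int k * m" using m_pos by simp
  ultimately show "- i0 - int k * m \<le> \<sigma> * j \<and> \<sigma> * j \<le> i0"
    using \<sigma> by (elim disjE) (simp_all, linarith+)
qed

lemma facing_start:
  assumes \<sigma>: "\<sigma> = 1 \<or> \<sigma> = -1" shows "\<exists>c. facing \<sigma> 0 c x"
proof (cases "facing \<sigma> 0 True x")
  case False
  then obtain i where i: "orbit_map z (f True) i \<in> proj (axis True) x"
      "\<not> (- i0 \<le> \<sigma> * i \<and> \<sigma> * i \<le> i0)"
    by (auto simp: facing_def)
  then have "i0 < \<bar>i\<bar>" using \<sigma> by auto
  from facing_of_far[OF \<sigma> i(1) this] show ?thesis by blast
qed blast

text \<open>The letter lowers \<open>\<sigma> * i\<close> on its own axis by \<open>e c\<close>,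
  from at most \<open>i0\<close> to below \<open>- i0\<close>. So this axis is still faced, and the
  other one is faced by \<open>facing_of_far\<close>.\<close>

lemma facing_step:
  assumes \<sigma>: "\<sigma> = 1 \<or> \<sigma> = -1" and x: "facing \<sigma> k c x"
  shows "facing \<sigma> (Suc k) c' (shift \<sigma> c x)"
proof -
  have b: "- i0 - int k * m - e c \<le> \<sigma> * i \<and> \<sigma> * i \<le> i0 - e c"
    if "orbit_map z (f c) i \<in> proj (axis c) (shift \<sigma> c x)" for i
  proof -
    have "orbit_map z (f c) (i + \<sigma> * e c) \<in> proj (axis c) x"
      using that mem_proj_orbit_shift[OF iso, of z c "i + \<sigma> * e c" "- \<sigma> * e c" x]
      by (simp add: axis_def shift_def)
    then have "- i0 - int k * m \<le> \<sigma> * (i + \<sigma> * e c) \<and> \<sigma> * (i + \<sigma> * e c) \<le> i0"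
      using x by (simp add: facing_def)
    moreover have "\<sigma> * (i + \<sigma> * e c) = \<sigma> * i + e c" using \<sigma> by auto
    ultimately show ?thesis by linarith
  qed
  show ?thesis
  proof (cases "c' = c")
    case True
    \<comment> \<open>The lower bound yields by \<open>m\<close> with each letter, which suffices
      because \<open>e c \<le> m\<close>.\<close>
    have "- i0 - int (Suc k) * m \<le> - i0 - int k * m - e c" "i0 - e c \<le> i0"
      using e_bounds[of c] i0 by (auto simp: algebra_simps)
    with b show ?thesis unfolding True facing_def by (meson order_trans)
  next
    case False
    obtain i where i: "orbit_map z (f c) i \<in> proj (axis c) (shift \<sigma> c x)" by (rule ex_proj)
    have "i0 < \<bar>i\<bar>" using b[OF i] \<sigma> e_bounds(1)[of c] by auto
    moreover have "c' = (\<not> c)" using False by auto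
    ultimately show ?thesis using facing_of_far[OF \<sigma> i] by simp
  qed
qed

lemma facing_mono: "facing \<sigma> k c x \<Longrightarrow> facing \<sigma> (Suc k) c x"
  using m_pos unfolding facing_def by (fastforce simp: algebra_simps)

lemma card_not_facing:
  assumes "\<sigma> = 1 \<or> \<sigma> = -1"
  shows "card {bs. length bs = n \<and> \<not> facing \<sigma> n True (fold (shift \<sigma>) bs x)} \<le> 1"
proof -
  have "card {bs. length bs = n \<and> \<not> facing \<sigma> n True (fold (shift \<sigma>) bs x)}
      \<le> card {bs. length bs = n \<and> \<not> (\<forall>c. facing \<sigma> n c (fold (shift \<sigma>) bs x))}"
    by (rule card_mono)
      (auto intro: finite_subset[OF _ finite_lists_length_eq[of "UNIV :: bool set" n]])
  also have "\<dots> \<le> 1"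
    using facing_start[OF assms] facing_step[OF assms] facing_mono by (rule card_bad_words_le_1)
  finally show ?thesis .
qed

lemma shift_minus: "shift (-1) = letter"
  by (simp add: fun_eq_iff shift_def letter_def)

lemma iso_letter: "isometry (letter c)"
  by (simp add: letter_def isometry_zpow iso)

lemma dist_shift: "dist (shift 1 c x) y = dist x (letter c y)"
proof -
  have bij: "bij (f c)" using iso by (simp add: isometry_def)
  have "letter c (shift 1 c x) = x"
    using zpow_add[OF bij, of "e c" "- e c"] by (simp add: letter_def shift_def fun_eq_iff zpow_def)
  then show ?thesis using isometry_dist[OF iso_letter] by metis
qed

lemma dist_fold_shift: "dist (fold (shift 1) bs x) y = dist x (foldr letter bs y)"
  by (induction bs arbitrary: x) (simp_all add: dist_shift)

lemma dist_foldr_letter: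
  assumes "\<And>c. dist z (letter c z) \<le> D"
  shows "dist z y - real (length bs) * D \<le> dist z (foldr letter bs y)"
    and "dist z (foldr letter bs z) \<le> real (length bs) * D"
proof -
  show "dist z y - real (length bs) * D \<le> dist z (foldr letter bs y)"
  proof (induction bs)
    case (Cons b bs)
    have "dist z (foldr letter bs y) = dist (letter b z) (letter b (foldr letter bs y))"
      using isometry_dist[OF iso_letter] by metis
    also have "\<dots> \<le> D + dist z (letter b (foldr letter bs y))"
      using assms[of b] dist_triangle[of "letter b z" "letter b (foldr letter bs y)" z]
      by (simp add: dist_commute)
    finally show ?case using Cons by (simp add: algebra_simps)
  qed auto
  show "dist z (foldr letter bs z) \<le> real (length bs) * D"
  proof (induction bs)
    case (Cons b bs)
    have "dist z (foldr letter bs z) = dist (letter b z) (letter b (foldr letter bs z))"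
      using isometry_dist[OF iso_letter] by metis
    then have "dist z (letter b (foldr letter bs z)) \<le> D + dist z (foldr letter bs z)"
      using assms[of b] dist_triangle[of z "letter b (foldr letter bs z)" "letter b z"] by simp
    then show ?case using Cons by (simp add: algebra_simps)
  qed auto
qed

text \<open>On the axis of the middle letter the projection of \<open>x'\<close> has index at most
  \<open>i0\<close>, while the letter carries that of \<open>y'\<close> from at least
  \<open>- i0\<close> to at least \<open>e True - i0\<close>. By \<open>separation\<close> the two
  are more than \<open>C\<close> apart, so the axis controls the distance. The outer letters cost a
  constant depending only on \<open>n\<close>.\<close>

lemma almost_additive:
  "\<exists>D. \<forall>x y bs cs. length bs = n \<longrightarrow> length cs = n \<longrightarrow>
     facing 1 n True (fold (shift 1) bs x) \<longrightarrow> facing (-1) n True (foldr letter cs y) \<longrightarrow>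
     dist x z + dist z y - D \<le> dist x (foldr letter bs (letter True (foldr letter cs y)))"
proof -
  \<comment> \<open>The indices that facing allows for either sign; there are finitely many, so
    their orbit points lie within a common \<open>D1\<close> of \<open>z\<close>.\<close>
  define J where "J = {- i0 - int n * m .. i0 + int n * m}"
  define D1 where "D1 = Max ((\<lambda>i. dist z (orbit_map z (f True) i)) ` J)"
  have D1: "dist z (orbit_map z (f True) i) \<le> D1" if "i \<in> J" for i
    unfolding D1_def by (rule Max_ge) (use that in \<open>auto simp: J_def\<close>)
  define D2 where "D2 = max (dist z (letter True z)) (dist z (letter False z))"
  have D2: "dist z (letter c z) \<le> D2" for c by (cases c) (auto simp: D2_def)
  define N where "N = real n * D2"
  have nm: "0 \<le> int n * m" using m_pos by simp
  show ?thesis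
  proof (intro exI[of _ "2 * D1 + C + 2 * N"] allI impI)
    fix x y bs cs
    assume len: "length bs = n" "length cs = n"
      and l: "facing 1 n True (fold (shift 1) bs x)" and r: "facing (-1) n True (foldr letter cs y)"
    define x' where "x' = fold (shift 1) bs x"
    define y' where "y' = foldr letter cs y"
    obtain i where i: "orbit_map z (f True) i \<in> proj (axis True) x'" by (rule ex_proj)
    obtain j where j: "orbit_map z (f True) j \<in> proj (axis True) y'" by (rule ex_proj)
    have ib: "- i0 - int n * m \<le> i" "i \<le> i0" using l i by (auto simp: facing_def x'_def)
    have jb: "- i0 \<le> j" "j \<le> i0 + int n * m" using r j by (auto simp: facing_def y'_def)
    let ?p = "orbit_map z (f True) i" and ?r = "orbit_map z (f True) j"
    let ?q = "orbit_map z (f True) (j + e True)"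
    have q: "?q \<in> proj (axis True) (letter True y')"
      using j mem_proj_orbit_shift[OF iso, of z True j "e True" y'] by (simp add: axis_def letter_def)
    have "C < dist ?p ?q" by (rule separation) (use ib jb in linarith)
    then have "dist x' ?p + dist ?p ?q + dist ?q (letter True y') - C \<le> dist x' (letter True y')"
      using proj_controlledD[OF ctl[of True]] i q unfolding axis_def by blast
    moreover have "dist ?q (letter True y') = dist ?r y'"
    proof -
      have bij: "bij (f True)" using iso by (simp add: isometry_def)
      have "?q = letter True ?r"
        using zpow_add[OF bij, of "e True" j] by (simp only: letter_def orbit_map_def add.commute comp_apply)
      then show ?thesis using isometry_dist[OF iso_letter] by simp
    qed
    moreover have "dist z ?p \<le> D1" "dist z ?r \<le> D1" using ib jb nm by (auto intro!: D1 simp: J_def)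
    moreover have "dist x' z \<le> dist x' ?p + dist z ?p" "dist z y' \<le> dist z ?r + dist ?r y'"
      by (simp_all add: dist_triangle dist_triangle2)
    moreover have "dist x z - N \<le> dist x' z"
    proof -
      have "dist x' z = dist x (foldr letter bs z)" by (simp add: x'_def dist_fold_shift)
      moreover have "dist z (foldr letter bs z) \<le> N"
        using dist_foldr_letter(2)[OF D2, of bs] len by (simp add: N_def)
      ultimately show ?thesis using dist_triangle2[of x z "foldr letter bs z"] by linarith
    qed
    moreover have "dist z y - N \<le> dist z y'"
      using dist_foldr_letter(1)[OF D2, of y cs] len by (simp add: N_def y'_def)
    ultimately have "dist x z + dist z y - (2 * D1 + C + 2 * N) \<le> dist x' (letter True y')"
      using zero_le_dist[of ?p ?q] by linarith
    then show "dist x z + dist z y - (2 * D1 + C + 2 * N)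
        \<le> dist x (foldr letter bs (letter True (foldr letter cs y)))"
      by (simp add: x'_def y'_def dist_fold_shift)
  qed
qed

text \<open>Ensures that different words give different blocks. If the letters agreed,
  \<open>letter True z\<close> would lie on both orbits and be its own projection to each;
  \<open>behr\<close> would put it within \<open>R\<close> of \<open>z\<close>, against
  \<open>2 * i0 < e True\<close>.\<close>

lemma letter_neq: "letter True \<noteq> letter False"
proof
  assume eq: "letter True = letter False"
  have orb: "letter c z = orbit_map z (f c) (e c)" for c by (simp add: letter_def orbit_map_def)
  have "letter True z \<in> proj (range (orbit_map z (f c))) (letter True z)" for c
  proof -
    have "letter True z = orbit_map z (f c) (e c)" using eq orb[of c] by (cases c) auto
    then show ?thesis by (auto simp: mem_proj_iff)
  qed
  from behr[OF this[of True] this[of "\<not> True"]] have "dist z (letter True z) \<le> R" by simp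
  then have "\<bar>e True\<bar> \<le> i0" using index_bound[of True "e True"] by (simp add: letter_def orbit_map_def)
  then show False using e_bounds(1)[of True] i0 by linarith
qed

lemma card_not_facing_right:
  "card {cs. length cs = n \<and> \<not> facing (-1) n True (foldr letter cs y)} \<le> 1"
proof -
  let ?B = "{bs. length bs = n \<and> \<not> facing (-1) n True (fold (shift (-1)) bs y)}"
  \<comment> \<open>Since \<open>foldr\<close> consumes the word from its end, reversal reduces the
    claim to \<open>card_not_facing\<close>.\<close>
  have "{cs. length cs = n \<and> \<not> facing (-1) n True (foldr letter cs y)} \<subseteq> rev ` ?B"
    by (auto simp: shift_minus foldr_conv_fold intro!: image_eqI[where x = "rev _"])
  moreover have "finite ?B"
    by (rule finite_subset[OF _ finite_lists_length_eq[of "UNIV :: bool set" n]]) auto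
  ultimately have "card {cs. length cs = n \<and> \<not> facing (-1) n True (foldr letter cs y)} \<le> card ?B"
    by (meson card_image_le card_mono finite_imageI order_trans)
  also have "\<dots> \<le> 1" by (rule card_not_facing) simp
  finally show ?thesis .
qed

end

section \<open>The expected defect of a walk with good blocks\<close>

text \<open>Here \<open>\<beta>\<close> is the law of one block and \<open>S\<close> a finite set of
  distinguished blocks. \<open>Lb x c\<close> means that \<open>c\<close> is bad for the past
  \<open>x\<close>, and \<open>Rb c y\<close> that it is bad for the future \<open>y\<close>; each
  side spoils at most one distinguished block in sixteen.\<close>

locale block_walk =
  fixes z :: "'a::metric_space" and \<beta> :: "'b pmf" and ev :: "'b \<Rightarrow> 'a \<Rightarrow> 'a"
    and S :: "'b set" and Lb :: "'a \<Rightarrow> 'b \<Rightarrow> bool" and Rb :: "'b \<Rightarrow> 'a \<Rightarrow> bool" and C M :: real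
  assumes iso: "c \<in> set_pmf \<beta> \<Longrightarrow> isometry (ev c)"
    and S: "finite S" "S \<noteq> {}" "S \<subseteq> set_pmf \<beta>"
    and card_Lb: "16 * card {c\<in>S. Lb x c} \<le> card S"
    and card_Rb: "16 * card {c\<in>S. Rb c y} \<le> card S"
    and good: "c \<in> S \<Longrightarrow> \<not> Lb x c \<Longrightarrow> \<not> Rb c y \<Longrightarrow> dist x z + dist z y - C \<le> dist x (ev c y)"
    and C: "0 \<le> C" and M: "0 \<le> M" "(\<integral>\<^sup>+c. ennreal (dist z (ev c z)) \<partial>\<beta>) \<le> ennreal M"
begin

section \<open>Weights of blocks\<close>

definition pmin :: real where "pmin = Min (pmf \<beta> ` S)"

text \<open>
  The weight has mean less than 1 when few blocks are bad, while \<open>wt b c * wt b' c \<ge> 1\<close> unless \<open>c\<close> is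
  a block of \<open>S\<close> that is good for both \<open>b\<close> and \<open>b'\<close>. The factor \<open>pmin / pmf \<beta> c\<close> makes all blocks of \<open>S\<close>
  count equally, whatever their probabilities.
\<close>

definition wt :: "('b \<Rightarrow> bool) \<Rightarrow> 'b \<Rightarrow> real" where
  "wt b c = (if c \<in> S then 1 + pmin / pmf \<beta> c * ((if b c then 4 else 1/4) - 1) else 1)"

definition \<rho> :: real where "\<rho> = 1 - pmin * card S / 2"

lemma pmin_pos: "0 < pmin"
  using S by (auto simp: pmin_def pmf_positive_iff)

lemma pmin_le: "c \<in> S \<Longrightarrow> pmin \<le> pmf \<beta> c"
  using S by (simp add: pmin_def)

lemma ratio_bounds: "c \<in> S \<Longrightarrow> 0 \<le> pmin / pmf \<beta> c \<and> pmin / pmf \<beta> c \<le> 1"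
  using pmin_le[of c] pmin_pos by auto

lemma card_S_pos: "0 < card S" using S by (simp add: card_gt_0_iff)

lemma rho_bounds: "0 \<le> \<rho>" "\<rho> < 1"
proof -
  have "pmin * card S = (\<Sum>c\<in>S. pmin)" by simp
  also have "\<dots> \<le> (\<Sum>c\<in>S. pmf \<beta> c)" by (rule sum_mono) (rule pmin_le)
  also have "\<dots> = measure_pmf.prob \<beta> S" using S by (simp add: measure_measure_pmf_finite)
  also have "\<dots> \<le> 1" by simp
  finally show "0 \<le> \<rho>" by (simp add: \<rho>_def)
  show "\<rho> < 1" using pmin_pos card_S_pos by (simp add: \<rho>_def)
qed

lemma wt_nonneg: "0 \<le> wt b c"
proof (cases "c \<in> S")
  case True
  define r where "r = pmin / pmf \<beta> c"
  have "wt b c = (if b c then 1 + 3 * r else 1 - 3/4 * r)"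
    using True by (simp add: wt_def r_def algebra_simps)
  then show ?thesis using ratio_bounds[OF True] by (simp add: r_def[symmetric])
qed (simp add: wt_def)

text \<open>The critical case is one bad side and one good side: with
  \<open>r = pmin / pmf \<beta> c\<close> the product is \<open>1 + 9/4 * (r * (1 - r))\<close>, and
  \<open>r\<close> lies between 0 and 1.\<close>

lemma one_le_wt_mult:
  assumes "c \<in> S \<Longrightarrow> b c \<or> b' c"
  shows "1 \<le> wt b c * wt b' c"
proof (cases "c \<in> S")
  case True
  define r where "r = pmin / pmf \<beta> c"
  have r: "0 \<le> r" "r \<le> 1" using ratio_bounds[OF True] by (auto simp: r_def)
  have 1: "1 \<le> (1 + 3 * r) * (1 - 3/4 * r)"
  proof -
    have "(1 + 3 * r) * (1 - 3/4 * r) - 1 = 9/4 * (r * (1 - r))" by (simp add: algebra_simps)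
    moreover have "0 \<le> r * (1 - r)" using r by simp
    ultimately show ?thesis by linarith
  qed
  have 2: "1 \<le> (1 + 3 * r) * (1 + 3 * r)" using r by (simp add: algebra_simps)
  have w: "wt d c = (if d c then 1 + 3 * r else 1 - 3/4 * r)" for d
    using True by (simp add: wt_def r_def algebra_simps)
  show ?thesis using assms[OF True] 1 2 by (auto simp: w mult.commute)
next
  case False
  then show ?thesis by (simp add: wt_def)
qed

lemma nn_integral_wt:
  assumes b: "16 * card {c\<in>S. b c} \<le> card S"
  shows "(\<integral>\<^sup>+c. ennreal (wt b c) \<partial>\<beta>) \<le> ennreal \<rho>"
proof -
  define h where "h = (\<lambda>s. pmin / pmf \<beta> s * ((if b s then 4 else 1/4) - 1))"
  \<comment> \<open>A constant plus finitely many indicators, so that the mean becomes a finite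
    sum.\<close>
  have wt: "wt b c = 1 + (\<Sum>s\<in>S. h s * indicator {s} c)" for c
  proof -
    have "(\<Sum>s\<in>S. h s * indicator {s} c) = (\<Sum>s\<in>S. if s = c then h c else 0)"
      by (rule sum.cong) auto
    then show ?thesis using S(1) by (simp add: wt_def h_def)
  qed
  have int: "integrable \<beta> (\<lambda>c. h s * indicator {s} c)" for s
    by (rule measure_pmf.integrable_const_bound[where B = "\<bar>h s\<bar>"]) (auto simp: indicator_def)
  have "(\<integral>c. wt b c \<partial>\<beta>) = 1 + (\<Sum>s\<in>S. h s * pmf \<beta> s)"
    unfolding wt using int by (subst Bochner_Integration.integral_add) (simp_all add: measure_pmf_single)
  also have "(\<Sum>s\<in>S. h s * pmf \<beta> s) = (\<Sum>s\<in>S. pmin * (if b s then 3 else -3/4))"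
  proof (rule sum.cong)
    fix s assume "s \<in> S"
    then have "pmf \<beta> s \<noteq> 0" using pmin_le[of s] pmin_pos by auto
    then show "h s * pmf \<beta> s = pmin * (if b s then 3 else -3/4)" by (simp add: h_def)
  qed simp
  also have "\<dots> = pmin * (\<Sum>s\<in>S. (if b s then 3 else -3/4))" by (simp add: sum_distrib_left)
  also have "(\<Sum>s\<in>S. (if b s then 3 else -3/4 :: real)) = 3 * card {c\<in>S. b c} - 3/4 * card {c\<in>S. \<not> b c}"
    using S(1) by (simp add: sum.If_cases Int_def Collect_neg_eq[symmetric])
  also have "real (card {c\<in>S. \<not> b c}) = real (card S) - real (card {c\<in>S. b c})"
  proof -
    have "card S = card {c\<in>S. b c} + card {c\<in>S. \<not> b c}"
      using S(1) by (subst card_Un_disjoint[symmetric]) (auto intro: arg_cong[where f = card])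
    then show ?thesis by simp
  qed
  finally have eq: "(\<integral>c. wt b c \<partial>\<beta>) = 1 + pmin * (3 * real (card {c\<in>S. b c}) - 3/4 * (real (card S) - real (card {c\<in>S. b c})))"
    by simp
  have "pmin * (3 * real (card {c\<in>S. b c}) - 3/4 * (real (card S) - card {c\<in>S. b c})) \<le> pmin * (- (card S / 2))"
  proof (rule mult_left_mono)
    have "16 * real (card {c\<in>S. b c}) \<le> card S" using b by (metis of_nat_le_iff of_nat_mult of_nat_numeral)
    \<comment> \<open>With a share of 1/16 bad blocks the average is
      \<open>3/16 - 45/64 = -33/64\<close>, just below \<open>-1/2\<close>.\<close>
    moreover have "3 * a - 3/4 * (n - a) \<le> - (n / 2)" if "16 * a \<le> n" "0 \<le> n" for a n :: real
      using that by (simp add: field_simps)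
    ultimately show "3 * real (card {c\<in>S. b c}) - 3/4 * (real (card S) - card {c\<in>S. b c}) \<le> - (card S / 2)"
      by simp
  qed (use pmin_pos in simp)
  then have "(\<integral>c. wt b c \<partial>\<beta>) \<le> \<rho>" unfolding eq \<rho>_def by simp
  moreover have "integrable \<beta> (wt b)" unfolding wt using int by (intro Bochner_Integration.integrable_add) auto
  ultimately show ?thesis
    by (subst nn_integral_eq_integral) (auto simp: wt_nonneg ennreal_leI)
qed

text \<open>Each displacement is discounted by the left weights of the blocks before it. These
  weights depend on the past only, so the mean is computed from the first block on.\<close>

primrec P :: "'a \<Rightarrow> 'b list \<Rightarrow> real" where
  "P x [] = 0"
| "P x (c # cs) = dist z (ev c z) + wt (Lb x) c * P (inv (ev c) x) cs"

text \<open>The same sum with right weights. The weight of a block depends on the blocks after it,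
  so the mean is computed from the last block backwards.\<close>

primrec Q :: "'a \<Rightarrow> 'b list \<Rightarrow> real" where
  "Q y [] = 0"
| "Q y (c # cs) = dist z (ev c z) + wt (\<lambda>c. Rb c (foldr ev cs y)) c * Q y cs"

lemma P_nonneg: "0 \<le> P x cs"
  by (induction cs arbitrary: x) (simp_all add: wt_nonneg)

lemma Q_nonneg: "0 \<le> Q y cs"
  by (induction cs) (simp_all add: wt_nonneg)

text \<open>
  A bad block replaces \<open>(s, t)\<close> by \<open>(s * a, t * b)\<close> with \<open>a * b \<ge> 1\<close>; then \<open>s + t \<ge> 2\<close> persists, so that
  the sum of the one-sided quantities \<open>P\<close> and \<open>Q\<close> dominates the defect.
\<close>

lemma defect_le:
  assumes "set cs \<subseteq> set_pmf \<beta>" "0 \<le> s" "0 \<le> t" "1 \<le> s * t"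
  shows "dist x z + dist z (foldr ev cs y) - dist x (foldr ev cs y) \<le> C + s * P x cs + t * Q y cs + 2 * dist z y"
  using assms
proof (induction cs arbitrary: x s t)
  case Nil
  then show ?case using C dist_triangle2[of x z y] by (simp add: dist_commute)
next
  case (Cons c cs)
  define v where "v = foldr ev cs y"
  have c: "isometry (ev c)" using Cons.prems(1) iso by simp
  define a where "a = wt (Lb x) c"
  define b where "b = wt (\<lambda>c. Rb c v) c"
  have ab: "0 \<le> a" "0 \<le> b" by (simp_all add: a_def b_def wt_nonneg)
  have st: "2 \<le> s + t"
  proof -
    have "0 \<le> (s - t)\<^sup>2" by simp
    then have "2\<^sup>2 \<le> (s + t)\<^sup>2" using Cons.prems(4) by (simp add: power2_eq_square algebra_simps)
    then show ?thesis by (rule power2_le_imp_le) (use Cons.prems(2,3) in simp)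
  qed
  have v1: "dist z (ev c v) \<le> dist z (ev c z) + dist z v"
    using dist_triangle[of z "ev c v" "ev c z"] isometry_dist[OF c, of z v] by simp
  \<comment> \<open>A good block ends the recursion at the cost of \<open>C\<close> and its
    displacement. Any other block is peeled off at the cost of twice its displacement, and the rest
    is viewed from \<open>inv (ev c) x\<close>.\<close>
  show ?case
  proof (cases "c \<in> S \<and> \<not> Lb x c \<and> \<not> Rb c v")
    case True
    then have "dist x z + dist z v - C \<le> dist x (ev c v)" using good by blast
    moreover have "0 \<le> s * (a * P (inv (ev c) x) cs)" "0 \<le> t * (b * Q y cs)"
      using Cons.prems ab P_nonneg Q_nonneg by simp_all
    moreover have "dist z (ev c z) \<le> (s + t) * dist z (ev c z)"
      using st mult_right_mono[of 1 "s + t" "dist z (ev c z)"] by simp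
    moreover have "s * P x (c # cs) + t * Q y (c # cs)
        = (s + t) * dist z (ev c z) + s * (a * P (inv (ev c) x) cs) + t * (b * Q y cs)"
      by (simp add: a_def b_def v_def algebra_simps)
    ultimately have "dist x z + dist z (ev c v) - dist x (ev c v)
        \<le> C + (s * P x (c # cs) + t * Q y (c # cs)) + 2 * dist z y"
      using v1 zero_le_dist[of z y] by linarith
    then show ?thesis by (simp add: v_def)
  next
    case False
    then have "1 \<le> a * b" unfolding a_def b_def by (intro one_le_wt_mult) auto
    then have "1 * 1 \<le> (s * t) * (a * b)" using Cons.prems(4) by (intro mult_mono) auto
    then have "1 \<le> (s * a) * (t * b)" by (simp add: ac_simps)
    moreover have "0 \<le> s * a" "0 \<le> t * b" using Cons.prems ab by simp_all
    ultimately have "dist (inv (ev c) x) z + dist z v - dist (inv (ev c) x) v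
        \<le> C + (s * a) * P (inv (ev c) x) cs + (t * b) * Q y cs + 2 * dist z y"
      unfolding v_def using Cons.IH Cons.prems(1) by simp
    moreover have "dist x z \<le> dist (inv (ev c) x) z + dist z (ev c z)"
      using dist_triangle2[of x z "ev c z"] by (simp add: isometry_dist_inv[OF c])
    moreover have "dist (inv (ev c) x) v = dist x (ev c v)" by (rule isometry_dist_inv[OF c])
    moreover have "2 * dist z (ev c z) \<le> (s + t) * dist z (ev c z)"
      using st by (intro mult_right_mono) auto
    moreover have "s * P x (c # cs) + t * Q y (c # cs)
        = (s + t) * dist z (ev c z) + (s * a) * P (inv (ev c) x) cs + (t * b) * Q y cs"
      by (simp add: a_def b_def v_def algebra_simps)
    ultimately have "dist x z + dist z (ev c v) - dist x (ev c v)
        \<le> C + (s * P x (c # cs) + t * Q y (c # cs)) + 2 * dist z y"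
      using v1 by linarith
    then show ?thesis by (simp add: v_def)
  qed
qed

text \<open>The fixed point of the recursion \<open>k = M + \<rho> * k\<close>, which bounds the
  means of both \<open>P\<close> and \<open>Q\<close>.\<close>

definition \<kappa> :: real where "\<kappa> = M / (1 - \<rho>)"

lemma kappa: "0 \<le> \<kappa>" "M + \<rho> * \<kappa> = \<kappa>"
  using rho_bounds M by (simp_all add: \<kappa>_def field_simps)

lemma recursion_bound:
  assumes "16 * card {c\<in>S. b c} \<le> card S"
  shows "(\<integral>\<^sup>+c. ennreal (dist z (ev c z)) + ennreal (wt b c) * ennreal \<kappa> \<partial>\<beta>) \<le> ennreal \<kappa>"
proof -
  have "(\<integral>\<^sup>+c. ennreal (dist z (ev c z)) + ennreal (wt b c) * ennreal \<kappa> \<partial>\<beta>)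
      = (\<integral>\<^sup>+c. ennreal (dist z (ev c z)) \<partial>\<beta>) + (\<integral>\<^sup>+c. ennreal (wt b c) \<partial>\<beta>) * ennreal \<kappa>"
    by (simp add: nn_integral_add nn_integral_multc)
  also have "\<dots> \<le> ennreal M + ennreal \<rho> * ennreal \<kappa>"
    using M nn_integral_wt[OF assms] by (intro add_mono mult_right_mono) auto
  also have "\<dots> = ennreal \<kappa>"
    using kappa M rho_bounds by (simp add: ennreal_mult[symmetric] ennreal_plus[symmetric] del: ennreal_plus)
  finally show ?thesis .
qed

lemma nn_integral_P: "(\<integral>\<^sup>+cs. ennreal (P x cs) \<partial>replicate_pmf n \<beta>) \<le> ennreal \<kappa>"
proof (induction n arbitrary: x)
  case 0
  then show ?case by simp
next
  case (Suc n)
  have "(\<integral>\<^sup>+cs. ennreal (P x cs) \<partial>replicate_pmf (Suc n) \<beta>)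
     = (\<integral>\<^sup>+c. (\<integral>\<^sup>+cs. ennreal (dist z (ev c z)) + ennreal (wt (Lb x) c) * ennreal (P (inv (ev c) x) cs)
          \<partial>replicate_pmf n \<beta>) \<partial>\<beta>)"
    by (simp add: ennreal_plus ennreal_mult wt_nonneg P_nonneg)
  also have "\<dots> = (\<integral>\<^sup>+c. ennreal (dist z (ev c z)) + ennreal (wt (Lb x) c) *
      (\<integral>\<^sup>+cs. ennreal (P (inv (ev c) x) cs) \<partial>replicate_pmf n \<beta>) \<partial>\<beta>)"
    by (simp add: nn_integral_add nn_integral_cmult measure_pmf.emeasure_space_1)
  also have "\<dots> \<le> (\<integral>\<^sup>+c. ennreal (dist z (ev c z)) + ennreal (wt (Lb x) c) * ennreal \<kappa> \<partial>\<beta>)"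
    using Suc.IH by (intro nn_integral_mono add_mono mult_left_mono) auto
  also have "\<dots> \<le> ennreal \<kappa>" by (rule recursion_bound[OF card_Lb])
  finally show ?case .
qed

lemma nn_integral_Q: "(\<integral>\<^sup>+cs. ennreal (Q y cs) \<partial>replicate_pmf n \<beta>) \<le> ennreal \<kappa>"
proof (induction n)
  case 0
  then show ?case by simp
next
  case (Suc n)
  \<comment> \<open>The tail is drawn first, because the right weight of \<open>c\<close> depends on
    it.\<close>
  have "replicate_pmf (Suc n) \<beta> = bind_pmf (replicate_pmf n \<beta>) (\<lambda>cs. bind_pmf \<beta> (\<lambda>c. return_pmf (c # cs)))"
    by (simp add: bind_commute_pmf[of \<beta>])
  then have "(\<integral>\<^sup>+cs. ennreal (Q y cs) \<partial>replicate_pmf (Suc n) \<beta>)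
     = (\<integral>\<^sup>+cs. (\<integral>\<^sup>+c. ennreal (dist z (ev c z)) + ennreal (wt (\<lambda>c. Rb c (foldr ev cs y)) c) * ennreal (Q y cs)
          \<partial>\<beta>) \<partial>replicate_pmf n \<beta>)"
    by (simp add: ennreal_plus ennreal_mult wt_nonneg Q_nonneg del: replicate_pmf.simps)
  also have "\<dots> \<le> (\<integral>\<^sup>+cs. ennreal M + ennreal \<rho> * ennreal (Q y cs) \<partial>replicate_pmf n \<beta>)"
    using M nn_integral_wt[OF card_Rb]
    by (intro nn_integral_mono) (simp add: nn_integral_add nn_integral_multc add_mono mult_right_mono)
  also have "\<dots> = ennreal M + ennreal \<rho> * (\<integral>\<^sup>+cs. ennreal (Q y cs) \<partial>replicate_pmf n \<beta>)"
    by (simp add: nn_integral_add nn_integral_cmult measure_pmf.emeasure_space_1)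
  also have "\<dots> \<le> ennreal M + ennreal \<rho> * ennreal \<kappa>"
    using Suc.IH by (intro add_mono mult_left_mono) auto
  also have "\<dots> = ennreal \<kappa>"
    using kappa M rho_bounds by (simp add: ennreal_mult[symmetric] ennreal_plus[symmetric] del: ennreal_plus)
  finally show ?case .
qed

lemma nn_integral_defect:
  "(\<integral>\<^sup>+cs. ennreal (dist x z + dist z (foldr ev cs y) - dist x (foldr ev cs y)) \<partial>replicate_pmf n \<beta>)
     \<le> ennreal (C + 2 * \<kappa> + 2 * dist z y)"
proof -
  have "(\<integral>\<^sup>+cs. ennreal (dist x z + dist z (foldr ev cs y) - dist x (foldr ev cs y)) \<partial>replicate_pmf n \<beta>)
    \<le> (\<integral>\<^sup>+cs. ennreal (C + 2 * dist z y) + (ennreal (P x cs) + ennreal (Q y cs)) \<partial>replicate_pmf n \<beta>)"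
  proof (rule nn_integral_mono_AE, unfold AE_measure_pmf_iff, rule ballI)
    fix cs assume "cs \<in> set_pmf (replicate_pmf n \<beta>)"
    then have "set cs \<subseteq> set_pmf \<beta>" by (auto simp: set_replicate_pmf)
    from defect_le[OF this, of 1 1 x y]
    have "dist x z + dist z (foldr ev cs y) - dist x (foldr ev cs y) \<le> (C + 2 * dist z y) + (P x cs + Q y cs)"
      by simp
    then show "ennreal (dist x z + dist z (foldr ev cs y) - dist x (foldr ev cs y))
        \<le> ennreal (C + 2 * dist z y) + (ennreal (P x cs) + ennreal (Q y cs))"
      using C P_nonneg[of x cs] Q_nonneg[of y cs]
      by (simp add: ennreal_plus[symmetric] ennreal_leI del: ennreal_plus)
  qed
  also have "\<dots> = ennreal (C + 2 * dist z y) + ((\<integral>\<^sup>+cs. ennreal (P x cs) \<partial>replicate_pmf n \<beta>)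
      + (\<integral>\<^sup>+cs. ennreal (Q y cs) \<partial>replicate_pmf n \<beta>))"
    by (simp add: nn_integral_add measure_pmf.emeasure_space_1)
  also have "\<dots> \<le> ennreal (C + 2 * dist z y) + (ennreal \<kappa> + ennreal \<kappa>)"
    by (intro add_mono nn_integral_P nn_integral_Q order_refl)
  also have "\<dots> = ennreal (C + 2 * \<kappa> + 2 * dist z y)"
    using C kappa by (simp add: ennreal_plus[symmetric] del: ennreal_plus)
  finally show ?thesis .
qed

end

section \<open>Convolution powers\<close>

lemma conv_pow_add:
  "conv_pow \<mu> (m + n) = bind_pmf (conv_pow \<mu> m) (\<lambda>g. map_pmf (\<lambda>h. g \<circ> h) (conv_pow \<mu> n))"
proof (induction n)
  case 0
  then show ?case by (simp add: bind_return_pmf')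
next
  case (Suc n)
  then show ?case
    by (simp add: map_bind_pmf bind_assoc_pmf bind_map_pmf map_pmf_comp comp_def)
qed

lemma conv_pow_1: "conv_pow \<mu> (Suc 0) = \<mu>"
  by (simp add: bind_return_pmf comp_def id_def)

lemma conv_pow_Suc_left:
  "conv_pow \<mu> (Suc n) = bind_pmf \<mu> (\<lambda>g. map_pmf (\<lambda>h. g \<circ> h) (conv_pow \<mu> n))"
  using conv_pow_add[of \<mu> "Suc 0" n] by (simp only: conv_pow_1 add_Suc add_0)

section \<open>Words of increments and their values\<close>

definition word_eval :: "('a \<Rightarrow> 'a) list \<Rightarrow> 'a \<Rightarrow> 'a" where
  "word_eval l = foldr (\<circ>) l id"

lemma word_eval_simps [simp]:
  "word_eval [] = id" "word_eval (g # l) = g \<circ> word_eval l"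
  by (simp_all add: word_eval_def)

lemma word_eval_append: "word_eval (l @ l') = word_eval l \<circ> word_eval l'"
  by (induction l) (simp_all add: comp_assoc)

lemma word_eval_concat_replicate: "word_eval (concat (replicate n l)) = word_eval l ^^ n"
  by (induction n) (simp_all add: word_eval_append)

lemma word_eval_concat_map: "word_eval (concat (map L bs)) y = foldr (\<lambda>c. word_eval (L c)) bs y"
  by (induction bs) (simp_all add: word_eval_append)

lemma map_word_eval_replicate_pmf: "map_pmf word_eval (replicate_pmf n \<mu>) = conv_pow \<mu> n"
proof (induction n)
  case (Suc n)
  show ?case
    by (simp add: conv_pow_Suc_left map_bind_pmf bind_assoc_pmf map_pmf_comp Suc[symmetric] map_pmf_def[symmetric] comp_def
        del: conv_pow.simps)
qed simp

text \<open>Groups the increments into \<open>q\<close> independent blocks of length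
  \<open>N\<close>; the \<open>r\<close> left over stand at the far end, where they act on the base
  point first.\<close>

lemma conv_pow_blocks:
  "conv_pow \<mu> (N * q + r) = bind_pmf (conv_pow \<mu> r)
     (\<lambda>u. map_pmf (\<lambda>cs. foldr (\<lambda>c v. word_eval c \<circ> v) cs u) (replicate_pmf q (replicate_pmf N \<mu>)))"
proof (induction q)
  case 0
  then show ?case by (simp add: bind_return_pmf')
next
  case (Suc q)
  let ?\<beta> = "replicate_pmf N \<mu>" and ?F = "\<lambda>u cs. foldr (\<lambda>c v. word_eval c \<circ> v) cs u"
  have "conv_pow \<mu> (N * Suc q + r) = conv_pow \<mu> (N + (N * q + r))" by (simp add: algebra_simps)
  also have "\<dots> = bind_pmf ?\<beta> (\<lambda>c. bind_pmf (conv_pow \<mu> r)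
      (\<lambda>u. map_pmf (\<lambda>cs. word_eval c \<circ> ?F u cs) (replicate_pmf q ?\<beta>)))"
    unfolding conv_pow_add[of \<mu> N] Suc
    by (simp add: map_word_eval_replicate_pmf[of N, symmetric] bind_map_pmf map_bind_pmf map_pmf_comp)
  also have "\<dots> = bind_pmf (conv_pow \<mu> r) (\<lambda>u. bind_pmf ?\<beta>
      (\<lambda>c. map_pmf (\<lambda>cs. word_eval c \<circ> ?F u cs) (replicate_pmf q ?\<beta>)))"
    by (rule bind_commute_pmf)
  also have "\<dots> = bind_pmf (conv_pow \<mu> r) (\<lambda>u. map_pmf (?F u) (replicate_pmf (Suc q) ?\<beta>))"
    by (simp add: map_bind_pmf map_pmf_def bind_assoc_pmf bind_return_pmf)
  finally show ?case .
qed

lemma isometry_conv_pow: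
  assumes "\<And>g. g \<in> set_pmf \<mu> \<Longrightarrow> isometry g" "v \<in> set_pmf (conv_pow \<mu> n)"
  shows "isometry v"
  using assms(2)
  by (induction n arbitrary: v) (auto simp: isometry_id intro!: isometry_comp intro: assms(1))

lemma nn_integral_conv_pow_dist:
  assumes iso: "\<And>g. g \<in> set_pmf \<mu> \<Longrightarrow> isometry g"
    and M: "0 \<le> M" "(\<integral>\<^sup>+g. ennreal (dist z (g z)) \<partial>\<mu>) \<le> ennreal M"
  shows "(\<integral>\<^sup>+v. ennreal (dist z (v z)) \<partial>conv_pow \<mu> n) \<le> ennreal (real n * M)"
proof (induction n)
  case (Suc n)
  have "(\<integral>\<^sup>+v. ennreal (dist z (v z)) \<partial>conv_pow \<mu> (Suc n))
      = (\<integral>\<^sup>+g. (\<integral>\<^sup>+h. ennreal (dist z (g (h z))) \<partial>\<mu>) \<partial>conv_pow \<mu> n)" by simp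
  also have "\<dots> \<le> (\<integral>\<^sup>+g. (\<integral>\<^sup>+h. ennreal (dist z (g z)) + ennreal (dist z (h z)) \<partial>\<mu>) \<partial>conv_pow \<mu> n)"
  proof (rule nn_integral_mono_AE, unfold AE_measure_pmf_iff, intro ballI nn_integral_mono)
    fix g h assume "g \<in> set_pmf (conv_pow \<mu> n)"
    then have "isometry g" using isometry_conv_pow iso by blast
    then have "dist z (g (h z)) \<le> dist z (g z) + dist z (h z)"
      using dist_triangle[of z "g (h z)" "g z"] by (simp add: isometry_dist)
    then show "ennreal (dist z (g (h z))) \<le> ennreal (dist z (g z)) + ennreal (dist z (h z))"
      by (simp add: ennreal_plus[symmetric] ennreal_leI del: ennreal_plus)
  qed
  also have "\<dots> = (\<integral>\<^sup>+g. ennreal (dist z (g z)) \<partial>conv_pow \<mu> n) + (\<integral>\<^sup>+h. ennreal (dist z (h z)) \<partial>\<mu>)"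
    by (simp add: nn_integral_add measure_pmf.emeasure_space_1)
  also have "\<dots> \<le> ennreal (real n * M) + ennreal M" using Suc M by (intro add_mono)
  also have "\<dots> = ennreal (real (Suc n) * M)"
    using M(1) by (simp add: ennreal_plus[symmetric] algebra_simps del: ennreal_plus)
  finally show ?case .
qed simp

lemma semigroup_gen_word:
  assumes "g \<in> semigroup_gen A"
  obtains l where "l \<noteq> []" "set l \<subseteq> A" "word_eval l = g"
proof -
  have "\<exists>l. l \<noteq> [] \<and> set l \<subseteq> A \<and> word_eval l = g"
    using assms
  proof induction
    case (base g)
    then show ?case by (intro exI[of _ "[g]"]) simp
  next
    case (comp g h)
    then obtain l l' where "l \<noteq> []" "set l \<subseteq> A" "word_eval l = g" "set l' \<subseteq> A" "word_eval l' = h"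
      by blast
    then show ?case by (intro exI[of _ "l @ l'"]) (simp add: word_eval_append)
  qed
  with that show ?thesis by blast
qed

section \<open>Powers of the two isometries as blocks\<close>

lemma zpow_of_nat: "zpow g (int n) = g ^^ n"
  by (simp add: zpow_def)

text \<open>The exponents \<open>q * M\<close> and \<open>p * M\<close> are matched to words of
  lengths \<open>p\<close> and \<open>q\<close> for \<open>g\<close> and \<open>h\<close>: both
  powers are then spelled by \<open>p * q * M\<close> increments.\<close>

lemma independent_schottky_pair:
  fixes z :: "'a::metric_space" and p q :: nat
  assumes gs: "geodesic_space TYPE('a)" and g: "isometry g" and h: "isometry h"
    and ind: "independent z g h" and pq: "0 < p" "0 < q"
  obtains M C R i0 m where
    "schottky_pair z (\<lambda>c. if c then g else h) (\<lambda>c. int (if c then q * M else p * M)) C R i0 m"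
proof -
  let ?A = "range (orbit_map z g)" and ?B = "range (orbit_map z h)"
  obtain K K' where K: "K > 0" "contracting_axis K (orbit_map z g)"
    and K': "K' > 0" "contracting_axis K' (orbit_map z h)"
    using ind unfolding independent_def contracting_def by blast
  define C where "C = 8 * K + 8 * K'"
  have A: "proj_controlled C ?A"
    by (rule proj_controlled_mono[OF contracting_axis_proj_controlled[OF gs K(2,1)]])
      (use K' in \<open>simp add: C_def\<close>)
  have B: "proj_controlled C ?B"
    by (rule proj_controlled_mono[OF contracting_axis_proj_controlled[OF gs K'(2,1)]])
      (use K in \<open>simp add: C_def\<close>)
  have C: "0 \<le> C" using K K' by (simp add: C_def)
  have "bounded (proj_set ?A ?B \<union> proj_set ?B ?A)" using ind by (simp add: independent_def)
  then obtain R0 where "proj_set ?A ?B \<union> proj_set ?B ?A \<subseteq> cball z R0"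
    unfolding bounded_any_center[of _ z] by (meson mem_cball subsetI)
  then have R0: "proj_set ?A ?B \<subseteq> cball z R0" "proj_set ?B ?A \<subseteq> cball z R0" by auto
  define R where "R = R0 + 2 * C"
  \<comment> \<open>The lower quasigeodesic bound, solved for the difference of the indices.\<close>
  have idx: "\<bar>real_of_int (j - i)\<bar> \<le> k * (T + k)"
    if "contracting_axis k f" "k > 0" "dist (f i) (f j) \<le> T" for k T i j and f :: "int \<Rightarrow> 'a"
  proof -
    have "\<bar>real_of_int (i - j)\<bar> / k - k \<le> dist (f i) (f j)"
      using that(1) unfolding contracting_axis_def quasigeodesic_def by blast
    then have "\<bar>real_of_int (i - j)\<bar> / k \<le> T + k" using that(3) by linarith
    then have "\<bar>real_of_int (i - j)\<bar> \<le> k * (T + k)" using that(2) by (simp add: field_simps)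
    then show ?thesis by (simp add: abs_minus_commute)
  qed
  define i0 where "i0 = max 0 (max \<lceil>K * (R + K)\<rceil> \<lceil>K' * (R + K')\<rceil>)"
  \<comment> \<open>The summand \<open>2 * i0\<close> clears the window of indices near
    \<open>z\<close>; the rest forces a distance above \<open>C\<close> along the axis of
    \<open>g\<close>.\<close>
  define M where "M = nat (2 * i0 + \<bar>\<lceil>K * (C + K)\<rceil>\<bar> + 1)"
  have M: "int M = 2 * i0 + \<bar>\<lceil>K * (C + K)\<rceil>\<bar> + 1" by (simp add: M_def i0_def)
  have le: "int M \<le> int (r * M)" if "0 < r" for r
    using that by (cases r) auto
  have z0: "orbit_map z f 0 = z" for f by (simp add: orbit_map_def zpow_def)
  have "schottky_pair z (\<lambda>c. if c then g else h) (\<lambda>c. int (if c then q * M else p * M)) C R i0 (int ((p + q) * M))"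
  proof
    show "isometry (if c then g else h)" for c using g h by simp
    show "proj_controlled C (range (orbit_map z (if c then g else h)))" for c using A B by simp
    show "dist z p \<le> R \<or> dist z q \<le> R"
      if "p \<in> proj (range (orbit_map z (if c then g else h))) x"
        "q \<in> proj (range (orbit_map z (if \<not> c then g else h))) x" for p q c x
      using that behrstock_inequality[OF A B C R0, of _ x] unfolding R_def by (cases c) auto
    show "\<bar>i\<bar> \<le> i0" if "dist z (orbit_map z (if c then g else h) i) \<le> R" for c i
    proof (cases c)
      case True
      then have "\<bar>real_of_int i\<bar> \<le> K * (R + K)" using idx[OF K(2,1), of 0 i R] that z0 by simp
      then show ?thesis unfolding i0_def by linarith
    next
      case False
      then have "\<bar>real_of_int i\<bar> \<le> K' * (R + K')" using idx[OF K'(2,1), of 0 i R] that z0 by simp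
      then show ?thesis unfolding i0_def by linarith
    qed
    show "2 * i0 < int (if c then q * M else p * M)" for c
      using le[OF pq(1)] le[OF pq(2)] M by (cases c) auto
    show "int (if c then q * M else p * M) \<le> int ((p + q) * M)" for c
      by (cases c) (simp_all add: distrib_right)
    show "0 \<le> i0" by (simp add: i0_def)
    show "C < dist (orbit_map z (if True then g else h) i) (orbit_map z (if True then g else h) j)"
      if "int (if True then q * M else p * M) - 2 * i0 \<le> j - i" for i j
    proof (rule ccontr)
      assume "\<not> ?thesis"
      then have "\<bar>real_of_int (j - i)\<bar> \<le> K * (C + K)" using idx[OF K(2,1), of i j C] by simp
      then have "j - i \<le> \<lceil>K * (C + K)\<rceil>" by linarith
      then show False using that le[OF pq(2)] M by simp
    qed
  qed
  with that show ?thesis by blast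
qed

lemma isometry_word_eval:
  "(\<And>g. g \<in> set l \<Longrightarrow> isometry g) \<Longrightarrow> isometry (word_eval l)"
  by (induction l) (auto simp: isometry_id intro!: isometry_comp)

text \<open>Code words of a common length can be read off one at a time.\<close>

lemma inj_on_concat_map:
  assumes inj: "inj L" and len: "\<And>c. length (L c) = n"
  shows "concat (map L xs) = concat (map L ys) \<Longrightarrow> length xs = length ys \<Longrightarrow> xs = ys"
proof (induction xs arbitrary: ys)
  case (Cons x xs)
  then obtain y ys' where ys: "ys = y # ys'" by (cases ys) auto
  with Cons show ?case using inj len by (auto simp: inj_eq)
qed simp

text \<open>The distinguished blocks spell nine letters: four that make the past face the axis, one
  fixed letter along it, and four that do the same for the future.\<close>

lemma bounded_expected_defect:
  fixes z :: "'a::metric_space"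
  assumes gs: "geodesic_space TYPE('a)" and iso: "\<And>g. g \<in> set_pmf \<mu> \<Longrightarrow> isometry g"
    and ne: "non_elementary z \<mu>"
    and M1: "0 \<le> M1" "(\<integral>\<^sup>+g. ennreal (dist z (g z)) \<partial>\<mu>) \<le> ennreal M1"
  obtains D where "0 \<le> D"
    "\<And>x n. (\<integral>\<^sup>+v. ennreal (dist x z + dist z (v z) - dist x (v z)) \<partial>conv_pow \<mu> n) \<le> ennreal D"
proof -
  obtain g h where gh: "g \<in> semigroup_gen (set_pmf \<mu>)" "h \<in> semigroup_gen (set_pmf \<mu>)" "independent z g h"
    using ne unfolding non_elementary_def by blast
  obtain lg where lg: "lg \<noteq> []" "set lg \<subseteq> set_pmf \<mu>" "word_eval lg = g"
    using gh(1) by (rule semigroup_gen_word)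
  obtain lh where lh: "lh \<noteq> []" "set lh \<subseteq> set_pmf \<mu>" "word_eval lh = h"
    using gh(2) by (rule semigroup_gen_word)
  have isog: "isometry g" and isoh: "isometry h"
    using lg lh iso isometry_word_eval by blast+
  define p where "p = length lg"
  define q where "q = length lh"
  have "0 < p" "0 < q" using lg lh by (simp_all add: p_def q_def)
  from independent_schottky_pair[OF gs isog isoh gh(3) this]
  obtain M C R i0 m where
    sp: "schottky_pair z (\<lambda>c. if c then g else h) (\<lambda>c. int (if c then q * M else p * M)) C R i0 m" .
  interpret sp: schottky_pair z "\<lambda>c. if c then g else h" "\<lambda>c. int (if c then q * M else p * M)" C R i0 m
    by (rule sp)
  define L where "L = (\<lambda>c. if c then concat (replicate (q * M) lg) else concat (replicate (p * M) lh))"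
  define N0 where "N0 = p * q * M"
  have lenL: "length (L c) = N0" for c
    by (simp add: L_def N0_def length_concat sum_list_replicate p_def q_def ac_simps)
  have setL: "set (L c) \<subseteq> set_pmf \<mu>" for c using lg lh by (auto simp: L_def)
  have evL: "word_eval (L c) = sp.letter c" for c
    unfolding L_def sp.letter_def
    by (simp add: word_eval_concat_replicate lg(3) lh(3) zpow_of_nat del: of_nat_mult)
  have injL: "inj L"
  proof (rule injI)
    fix c d assume "L c = L d"
    then have "sp.letter c = sp.letter d" using evL by metis
    then show "c = d" using sp.letter_neq by (cases c; cases d) auto
  qed
  define enc where "enc = (\<lambda>bs cs. concat (map L (bs @ True # cs)))"
  have ev_enc: "word_eval (enc bs cs) y = foldr sp.letter bs (sp.letter True (foldr sp.letter cs y))" for bs cs y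
    unfolding enc_def word_eval_concat_map by (simp add: evL)
  define N where "N = 9 * N0"
  define W where "W = {bs :: bool list. length bs = 4}"
  have cardW: "card W = 16" and finW: "finite W"
    using card_lists_length_eq[of "UNIV :: bool set" 4] finite_lists_length_eq[of "UNIV :: bool set" 4]
    by (simp_all add: W_def)
  \<comment> \<open>Of the 16 outer words on either side at most one is bad, so at most 16 of the
    256 blocks are bad for a given past or a given future.\<close>
  define S where "S = (\<lambda>(bs, cs). enc bs cs) ` (W \<times> W)"
  have "inj_on (\<lambda>(bs, cs). enc bs cs) (W \<times> W)"
    by (auto simp: inj_on_def enc_def W_def simp del: map_append list.map concat_append
        dest!: inj_on_concat_map[OF injL lenL])
  then have cardS: "card S = 256" by (simp add: S_def card_image card_cartesian_product cardW)
  define \<beta> where "\<beta> = replicate_pmf N \<mu>"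
  define Lb where "Lb = (\<lambda>x c. \<exists>bs\<in>W. \<exists>cs\<in>W. c = enc bs cs \<and> \<not> sp.facing 1 4 True (fold (sp.shift 1) bs x))"
  define Rb where "Rb = (\<lambda>c y. \<exists>bs\<in>W. \<exists>cs\<in>W. c = enc bs cs \<and> \<not> sp.facing (-1) 4 True (foldr sp.letter cs y))"
  obtain D0 where D0: "\<And>x y bs cs. length bs = 4 \<Longrightarrow> length cs = 4 \<Longrightarrow>
     sp.facing 1 4 True (fold (sp.shift 1) bs x) \<Longrightarrow> sp.facing (-1) 4 True (foldr sp.letter cs y) \<Longrightarrow>
     dist x z + dist z y - D0 \<le> dist x (foldr sp.letter bs (sp.letter True (foldr sp.letter cs y)))"
    using sp.almost_additive[of 4] by blast
  have map_\<beta>: "map_pmf word_eval \<beta> = conv_pow \<mu> N" by (simp add: \<beta>_def map_word_eval_replicate_pmf)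
  interpret bw: block_walk z \<beta> word_eval S Lb Rb "max 0 D0" "real N * M1"
  proof
    show "isometry (word_eval c)" if "c \<in> set_pmf \<beta>" for c
      using that iso by (intro isometry_word_eval) (auto simp: \<beta>_def set_replicate_pmf)
    show "finite S" using finW by (simp add: S_def)
    show "S \<noteq> {}" using cardS by auto
    show "S \<subseteq> set_pmf \<beta>"
    proof
      fix c assume "c \<in> S"
      then obtain bs cs where c: "bs \<in> W" "cs \<in> W" "c = enc bs cs" by (auto simp: S_def)
      have "length (concat (map L xs)) = length xs * N0" for xs
        by (induction xs) (simp_all add: lenL)
      then have "length c = N" using c by (simp add: enc_def W_def N_def del: map_append list.map concat_append)
      moreover have "set c \<subseteq> set_pmf \<mu>" using c setL by (auto simp: enc_def)
      ultimately show "c \<in> set_pmf \<beta>" by (auto simp: \<beta>_def set_replicate_pmf)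
    qed
    show "16 * card {c \<in> S. Lb x c} \<le> card S" for x
    proof -
      let ?B = "{bs. length bs = 4 \<and> \<not> sp.facing 1 4 True (fold (sp.shift 1) bs x)}"
      have B: "finite ?B" by (rule finite_subset[OF _ finW]) (auto simp: W_def)
      have "{c \<in> S. Lb x c} \<subseteq> (\<lambda>(bs, cs). enc bs cs) ` (?B \<times> W)"
        by (auto simp: Lb_def W_def)
      then have "card {c \<in> S. Lb x c} \<le> card (?B \<times> W)"
        by (rule surj_card_le[rotated]) (simp add: B finW)
      also have "\<dots> \<le> 16" using sp.card_not_facing[of 1 4 x] by (simp add: card_cartesian_product cardW)
      finally show ?thesis using cardS by simp
    qed
    show "16 * card {c \<in> S. Rb c y} \<le> card S" for y
    proof -
      let ?B = "{cs. length cs = 4 \<and> \<not> sp.facing (-1) 4 True (foldr sp.letter cs y)}"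
      have B: "finite ?B" by (rule finite_subset[OF _ finW]) (auto simp: W_def)
      have "{c \<in> S. Rb c y} \<subseteq> (\<lambda>(bs, cs). enc bs cs) ` (W \<times> ?B)"
        by (auto simp: Rb_def W_def)
      then have "card {c \<in> S. Rb c y} \<le> card (W \<times> ?B)"
        by (rule surj_card_le[rotated]) (simp add: B finW)
      also have "\<dots> \<le> 16" using sp.card_not_facing_right[of 4 y] by (simp add: card_cartesian_product cardW)
      finally show ?thesis using cardS by simp
    qed
    show "dist x z + dist z y - max 0 D0 \<le> dist x (word_eval c y)"
      if c_good: "c \<in> S" "\<not> Lb x c" "\<not> Rb c y" for c x y
    proof -
      obtain bs cs where c: "bs \<in> W" "cs \<in> W" "c = enc bs cs" using c_good(1) by (auto simp: S_def)
      have "sp.facing 1 4 True (fold (sp.shift 1) bs x)" "sp.facing (-1) 4 True (foldr sp.letter cs y)"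
        using c_good c unfolding Lb_def Rb_def by blast+
      then have "dist x z + dist z y - D0 \<le> dist x (word_eval c y)"
        using D0 c by (simp add: ev_enc W_def)
      then show ?thesis by linarith
    qed
    show "(\<integral>\<^sup>+c. ennreal (dist z (word_eval c z)) \<partial>\<beta>) \<le> ennreal (real N * M1)"
      using nn_integral_conv_pow_dist[OF iso M1, of N] unfolding map_\<beta>[symmetric] by simp
  qed (use M1 in simp_all)
  \<comment> \<open>The exponent bound makes the block length positive, as needed for
    \<open>n mod N < N\<close>.\<close>
  have "0 < int (q * M)" using sp.e_bounds(1)[of True] sp.i0 by (simp only: if_True)
  then have "0 < q * M" by (simp only: of_nat_0_less_iff)
  then have N: "0 < N" using \<open>0 < p\<close> by (simp add: N_def N0_def)
  define E where "E = max 0 D0 + 2 * bw.\<kappa>"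
  have E: "0 \<le> E" using bw.kappa by (simp add: E_def)
  have "(\<integral>\<^sup>+v. ennreal (dist x z + dist z (v z) - dist x (v z)) \<partial>conv_pow \<mu> n) \<le> ennreal (E + 2 * (real N * M1))" for x n
  proof -
    \<comment> \<open>The incomplete last block supplies the end point \<open>u z\<close>, whose
      mean displacement is at most \<open>real N * M1\<close>.\<close>
    define r where "r = n mod N"
    have n: "n = N * (n div N) + r" by (simp add: r_def)
    have ev: "foldr (\<lambda>c v. word_eval c \<circ> v) cs u z = foldr word_eval cs (u z)" for cs and u :: "'a \<Rightarrow> 'a"
      by (induction cs) simp_all
    have "(\<integral>\<^sup>+v. ennreal (dist x z + dist z (v z) - dist x (v z)) \<partial>conv_pow \<mu> n)
       = (\<integral>\<^sup>+u. (\<integral>\<^sup>+cs. ennreal (dist x z + dist z (foldr word_eval cs (u z)) - dist x (foldr word_eval cs (u z)))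
            \<partial>replicate_pmf (n div N) \<beta>) \<partial>conv_pow \<mu> r)"
      by (subst n, subst conv_pow_blocks) (simp add: ev \<beta>_def)
    also have "\<dots> \<le> (\<integral>\<^sup>+u. ennreal (E + 2 * dist z (u z)) \<partial>conv_pow \<mu> r)"
      unfolding E_def by (intro nn_integral_mono bw.nn_integral_defect)
    also have "\<dots> = ennreal E + 2 * (\<integral>\<^sup>+u. ennreal (dist z (u z)) \<partial>conv_pow \<mu> r)"
      using E by (simp add: ennreal_plus ennreal_mult nn_integral_add nn_integral_cmult measure_pmf.emeasure_space_1)
    also have "\<dots> \<le> ennreal E + 2 * ennreal (real r * M1)"
      by (intro add_mono mult_left_mono nn_integral_conv_pow_dist[OF iso M1]) auto
    also have "\<dots> = ennreal (E + 2 * (real r * M1))"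
      using E M1 by (simp add: ennreal_plus ennreal_mult)
    also have "\<dots> \<le> ennreal (E + 2 * (real N * M1))"
      using N M1 by (intro ennreal_leI add_left_mono mult_left_mono mult_right_mono) (auto simp: r_def)
    finally show ?thesis .
  qed
  moreover have "0 \<le> E + 2 * (real N * M1)" using E M1 by simp
  ultimately show ?thesis using that by blast
qed

section \<open>Continuity of the escape rate\<close>

text \<open>Fekete's lemma: if \<open>a N / N\<close> is close to the infimum, division of
  \<open>n\<close> by \<open>N\<close> with remainder gives
  \<open>a n \<le> (n div N) * a N + B\<close>.\<close>

lemma subadditive_convergent:
  fixes a :: "nat \<Rightarrow> real"
  assumes sub: "\<And>m n. a (m + n) \<le> a m + a n" and nn: "\<And>n. 0 \<le> a n"
  shows "convergent (\<lambda>n. a n / real n)"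
proof -
  define L where "L = (INF n\<in>{1..}. a n / real n)"
  have bdd: "bdd_below ((\<lambda>n. a n / real n) ` {1..})" by (rule bdd_belowI[of _ 0]) (auto simp: nn)
  have "(\<lambda>n. a n / real n) \<longlonglongrightarrow> L"
  proof (rule LIMSEQ_I)
    fix e :: real assume e: "0 < e"
    then have "L < L + e / 2" by simp
    then obtain N where N: "1 \<le> N" "a N / real N < L + e / 2"
      unfolding L_def using cInf_lessD[of "(\<lambda>n. a n / real n) ` {1..}" "L + e / 2"] by (auto simp: L_def)
    define B where "B = Max (a ` {..<N})"
    have B: "a r \<le> B" if "r < N" for r unfolding B_def using that by (intro Max_ge) auto
    have B0: "0 \<le> B" using nn[of 0] B[of 0] N by linarith
    have q: "a (N * q + r) \<le> real q * a N + a r" for q r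
    proof (induction q)
      case (Suc q)
      have "a (N * Suc q + r) \<le> a N + a (N * q + r)" using sub[of N "N * q + r"] by (simp add: algebra_simps)
      with Suc show ?case by (simp add: algebra_simps)
    qed simp
    obtain n0 :: nat where n0: "2 * B / e < real n0" using reals_Archimedean2 by blast
    have "norm (a n / real n - L) < e" if "n \<ge> max 1 n0" for n
    proof -
      have n: "0 < real n" using that by simp
      have lower: "L \<le> a n / real n" unfolding L_def using that by (intro cINF_lower bdd) auto
      have "a n \<le> real (n div N) * a N + B"
        using q[of "n div N" "n mod N"] B[of "n mod N"] N(1) by (simp add: less_eq_Suc_le[symmetric])
      also have "real (n div N) * a N \<le> real n * (a N / real N)"
      proof -
        have "real (n div N * N) \<le> real n" by (rule of_nat_mono) (rule div_times_less_eq_dividend)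
        then have "real (n div N) \<le> real n / real N" using N(1) by (simp add: field_simps)
        then have "real (n div N) * a N \<le> real n / real N * a N" by (rule mult_right_mono) (rule nn)
        then show ?thesis by simp
      qed
      also have "B < e / 2 * real n"
      proof -
        have "2 * B / e < real n" using n0 that by linarith
        then show ?thesis using e by (simp add: field_simps)
      qed
      finally have "a n < real n * (a N / real N) + e / 2 * real n" by simp
      then have "a n / real n < a N / real N + e / 2" using n by (simp add: field_simps)
      with N(2) lower show ?thesis by simp
    qed
    then show "\<exists>no. \<forall>n\<ge>no. norm (a n / real n - L) < e" by blast
  qed
  then show ?thesis by (rule convergentI)
qed

section \<open>Infinite sums as integrals against counting measure\<close>

lemma summable_on_integral_count_space:
  fixes f :: "'b \<Rightarrow> real"
  assumes "f summable_on UNIV"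
  shows "integrable (count_space UNIV) f" "infsum f UNIV = (\<integral>x. f x \<partial>count_space UNIV)"
proof -
  have f: "Infinite_Set_Sum.abs_summable_on f UNIV"
    using assms summable_on_iff_abs_summable_on_real abs_summable_equivalent by blast
  then show "integrable (count_space UNIV) f" by (simp add: Infinite_Set_Sum.abs_summable_on_def)
  show "infsum f UNIV = (\<integral>x. f x \<partial>count_space UNIV)"
    using infsetsum_infsum[OF f] by (simp add: infsetsum_def)
qed

lemma integrable_count_space_summable_on:
  fixes f :: "'b \<Rightarrow> real"
  assumes "integrable (count_space UNIV) f"
  shows "f summable_on UNIV"
  using assms summable_on_iff_abs_summable_on_real abs_summable_equivalent
  unfolding Infinite_Set_Sum.abs_summable_on_def by blast

lemma integrable_measure_pmf_iff:
  fixes f :: "'b \<Rightarrow> real"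
  shows "integrable (measure_pmf p) f \<longleftrightarrow> integrable (count_space UNIV) (\<lambda>x. pmf p x * f x)"
  by (simp add: measure_pmf_eq_density integrable_density)

lemma expectation_count_space:
  fixes f :: "'b \<Rightarrow> real"
  shows "measure_pmf.expectation p f = (\<integral>x. pmf p x * f x \<partial>count_space UNIV)"
  by (simp add: measure_pmf_eq_density integral_density)

text \<open>Extended-real counterpart of \<open>L_mean\<close>: it detects divergence, whereas
  \<open>infsum\<close> of a non-summable family is 0.\<close>

definition moment :: "'a::metric_space \<Rightarrow> ('a \<Rightarrow> 'a) pmf \<Rightarrow> ennreal" where
  "moment z p = (\<integral>\<^sup>+g. ennreal (dist z (g z)) \<partial>p)"

lemma integrable_dist:
  assumes "moment z p < \<infinity>" shows "integrable (measure_pmf p) (\<lambda>g. dist z (g z))"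
  using assms unfolding moment_def by (intro integrableI_nonneg) auto

lemma ennreal_L_mean:
  assumes "moment z p < \<infinity>"
  shows "ennreal (L_mean z p) = moment z p"
proof -
  have int: "integrable (count_space UNIV) (\<lambda>g. pmf p g * dist z (g z))"
    using integrable_dist[OF assms] by (simp only: integrable_measure_pmf_iff)
  have "L_mean z p = measure_pmf.expectation p (\<lambda>g. dist z (g z))"
    unfolding L_mean_def word_norm_def expectation_count_space
    by (rule summable_on_integral_count_space(2)[OF integrable_count_space_summable_on[OF int]])
  then show ?thesis
    unfolding moment_def using integrable_dist[OF assms] by (simp add: nn_integral_eq_integral)
qed

lemma L_mean_nonneg: "0 \<le> L_mean z p"
  unfolding L_mean_def by (rule infsum_nonneg) (simp add: word_norm_def)

lemma moment_finite:
  assumes "finite_first_moment z p" shows "moment z p < \<infinity>"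
proof -
  have "integrable (measure_pmf p) (\<lambda>g. dist z (g z))"
    using assms unfolding finite_first_moment_def word_norm_def integrable_measure_pmf_iff
    by (simp add: mult.commute summable_on_integral_count_space(1))
  then show ?thesis
    unfolding moment_def by (simp add: nn_integral_eq_integral)
qed

text \<open>Growth at most \<open>D + dist z (g z)\<close> is what \<open>norm01\<close> can absorb,
  with factor \<open>max 1 D\<close>. The bound is asked for on the supports alone, since isometries
  are known only there and the signed measure vanishes elsewhere.\<close>

lemma expectation_diff_le:
  fixes \<phi> :: "('a::metric_space \<Rightarrow> 'a) \<Rightarrow> real"
  assumes fin: "finite_norm01 z (\<lambda>g. pmf p g - pmf p' g)"
    and mom: "moment z p < \<infinity>" "moment z p' < \<infinity>" and D: "0 \<le> D"
    and \<phi>: "\<And>g. g \<in> set_pmf p \<union> set_pmf p' \<Longrightarrow> \<bar>\<phi> g\<bar> \<le> D + dist z (g z)"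
  shows "integrable p \<phi>" "integrable p' \<phi>"
    "\<bar>measure_pmf.expectation p \<phi> - measure_pmf.expectation p' \<phi>\<bar> \<le> max 1 D * norm01 z (\<lambda>g. pmf p g - pmf p' g)"
proof -
  have int: "integrable r \<phi>" if r: "moment z r < \<infinity>" "set_pmf r \<subseteq> set_pmf p \<union> set_pmf p'" for r
  proof (rule Bochner_Integration.integrable_bound)
    show "integrable r (\<lambda>g. D + dist z (g z))"
      using integrable_dist[OF r(1)] by (intro Bochner_Integration.integrable_add) auto
    show "AE g in measure_pmf r. norm (\<phi> g) \<le> norm (D + dist z (g z))"
      using \<phi> r(2) D by (fastforce simp: AE_measure_pmf_iff)
  qed simp
  show i1: "integrable p \<phi>" and i2: "integrable p' \<phi>" using int mom by auto
  let ?\<eta> = "\<lambda>g. pmf p g - pmf p' g" and ?c = "count_space (UNIV :: ('a \<Rightarrow> 'a) set)"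
  have s0: "(\<lambda>g. \<bar>?\<eta> g\<bar>) summable_on UNIV" and s1: "(\<lambda>g. dist z (g z) * \<bar>?\<eta> g\<bar>) summable_on UNIV"
    using fin by (simp_all add: finite_norm01_def word_norm_def)
  have n: "norm01 z ?\<eta> = (\<integral>g. \<bar>?\<eta> g\<bar> \<partial>?c) + (\<integral>g. dist z (g z) * \<bar>?\<eta> g\<bar> \<partial>?c)"
    unfolding norm01_def norm0_def norm1_def word_norm_def
    using summable_on_integral_count_space(2)[OF s0] summable_on_integral_count_space(2)[OF s1] by simp
  have c: "integrable ?c (\<lambda>g. pmf p g * \<phi> g)" "integrable ?c (\<lambda>g. pmf p' g * \<phi> g)"
    using i1 i2 by (simp_all only: integrable_measure_pmf_iff)
  have "measure_pmf.expectation p \<phi> - measure_pmf.expectation p' \<phi> = (\<integral>g. ?\<eta> g * \<phi> g \<partial>?c)"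
    unfolding expectation_count_space using c
    by (subst Bochner_Integration.integral_diff[symmetric]) (auto simp: algebra_simps)
  also have "\<bar>\<dots>\<bar> \<le> (\<integral>g. max 1 D * (\<bar>?\<eta> g\<bar> + dist z (g z) * \<bar>?\<eta> g\<bar>) \<partial>?c)"
  proof (rule order_trans[OF integral_abs_bound], rule integral_mono)
    show "integrable ?c (\<lambda>g. \<bar>?\<eta> g * \<phi> g\<bar>)"
      using Bochner_Integration.integrable_diff[OF c] by (intro integrable_abs) (simp add: algebra_simps)
    show "integrable ?c (\<lambda>g. max 1 D * (\<bar>?\<eta> g\<bar> + dist z (g z) * \<bar>?\<eta> g\<bar>))"
      using summable_on_integral_count_space(1)[OF s0] summable_on_integral_count_space(1)[OF s1] by simp
    fix g
    show "\<bar>?\<eta> g * \<phi> g\<bar> \<le> max 1 D * (\<bar>?\<eta> g\<bar> + dist z (g z) * \<bar>?\<eta> g\<bar>)"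
    proof (cases "g \<in> set_pmf p \<union> set_pmf p'")
      case True
      have "dist z (g z) \<le> max 1 D * dist z (g z)" using mult_right_mono[of 1 "max 1 D" "dist z (g z)"] by simp
      then have "\<bar>\<phi> g\<bar> \<le> max 1 D * (1 + dist z (g z))" using \<phi>[OF True] by (simp add: distrib_left)
      then have "\<bar>?\<eta> g\<bar> * \<bar>\<phi> g\<bar> \<le> \<bar>?\<eta> g\<bar> * (max 1 D * (1 + dist z (g z)))" by (rule mult_left_mono) simp
      then show ?thesis unfolding abs_mult by (simp add: algebra_simps)
    next
      case False
      then have "?\<eta> g = 0" by (simp add: set_pmf_iff)
      then show ?thesis by simp
    qed
  qed
  also have "\<dots> = max 1 D * norm01 z ?\<eta>"
    unfolding n using summable_on_integral_count_space(1)[OF s0] summable_on_integral_count_space(1)[OF s1] by simp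
  finally show "\<bar>measure_pmf.expectation p \<phi> - measure_pmf.expectation p' \<phi>\<bar> \<le> max 1 D * norm01 z ?\<eta>" .
qed

text \<open>Subtracting the constant \<open>c\<close> from \<open>\<psi>\<close> leaves the
  difference of the two expectations unchanged, as \<open>p\<close> and \<open>p'\<close> have mass
  1. The remainder \<open>\<phi> g\<close> is a displacement error of at most
  \<open>dist z (g z)\<close> minus an expected defect of at most \<open>D\<close>.\<close>

lemma replace_increment_le:
  fixes z :: "'a::metric_space"
  assumes u: "isometry u" and iso: "\<And>g. g \<in> set_pmf p \<union> set_pmf p' \<union> set_pmf V \<Longrightarrow> isometry g"
    and fin: "finite_norm01 z (\<lambda>g. pmf p g - pmf p' g)"
    and mom: "moment z p < \<infinity>" "moment z p' < \<infinity>" "moment z V < \<infinity>" and D: "0 \<le> D"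
    and defect: "\<And>x. (\<integral>\<^sup>+v. ennreal (dist x z + dist z (v z) - dist x (v z)) \<partial>V) \<le> ennreal D"
  shows "(\<integral>\<^sup>+g. (\<integral>\<^sup>+v. ennreal (dist z (u (g (v z)))) \<partial>V) \<partial>p)
    \<le> (\<integral>\<^sup>+g. (\<integral>\<^sup>+v. ennreal (dist z (u (g (v z)))) \<partial>V) \<partial>p')
      + ennreal (max 1 D * norm01 z (\<lambda>g. pmf p g - pmf p' g))"
proof -
  let ?E = measure_pmf.expectation
  define \<psi> where "\<psi> = (\<lambda>g. ?E V (\<lambda>v. dist z (u (g (v z)))))"
  define c where "c = dist z (u z) + ?E V (\<lambda>v. dist z (v z))"
  define \<phi> where "\<phi> = (\<lambda>g. \<psi> g - c)"
  have key: "(\<integral>\<^sup>+v. ennreal (dist z (u (g (v z)))) \<partial>V) = ennreal (\<psi> g) \<and> \<bar>\<phi> g\<bar> \<le> D + dist z (g z)"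
    if "g \<in> set_pmf p \<union> set_pmf p'" for g
  proof -
    have ug: "isometry (u \<circ> g)" using u iso that by (intro isometry_comp) auto
    \<comment> \<open>The base point pulled back through the past, so that \<open>defect\<close>
      applies to the future \<open>V\<close>.\<close>
    define x where "x = inv (u \<circ> g) z"
    have x: "dist x y = dist z (u (g y))" for y using isometry_dist_inv[OF ug] by (simp add: x_def)
    have iV: "integrable V (\<lambda>v. dist z (v z))" by (rule integrable_dist[OF mom(3)])
    have iX: "integrable V (\<lambda>v. dist x (v z))"
    proof (rule Bochner_Integration.integrable_bound)
      show "integrable V (\<lambda>v. dist x z + dist z (v z))" using iV by simp
      show "AE v in measure_pmf V. norm (dist x (v z)) \<le> norm (dist x z + dist z (v z))"
        by (simp add: dist_triangle)
    qed simp
    define d where "d = ?E V (\<lambda>v. dist x z + dist z (v z) - dist x (v z))"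
    have dd: "d = dist x z + ?E V (\<lambda>v. dist z (v z)) - \<psi> g"
      unfolding d_def \<psi>_def x[symmetric] using iV iX by simp
    have nn: "0 \<le> dist x z + dist z (v z) - dist x (v z)" for v :: "'a \<Rightarrow> 'a"
      using dist_triangle[of x "v z" z] by simp
    have "ennreal d = (\<integral>\<^sup>+v. ennreal (dist x z + dist z (v z) - dist x (v z)) \<partial>V)"
      unfolding d_def using iV iX nn by (subst nn_integral_eq_integral) auto
    then have "d \<le> D" using defect[of x] ennreal_le_iff[OF D, of d] by simp
    moreover have "0 \<le> d" unfolding d_def using nn by (simp add: integral_nonneg_AE)
    moreover have "\<bar>dist x z - dist z (u z)\<bar> \<le> dist z (g z)"
      unfolding x using abs_dist_diff_le[of z "u z" "u (g z)"] isometry_dist[OF u, of z "g z"]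
        abs_dist_diff_le[of "u (g z)" z "u z"] by (simp add: dist_commute abs_minus_commute)
    moreover have "\<phi> g = dist x z - dist z (u z) - d" unfolding \<phi>_def c_def dd by simp
    ultimately have "\<bar>\<phi> g\<bar> \<le> D + dist z (g z)" by linarith
    moreover have "(\<integral>\<^sup>+v. ennreal (dist z (u (g (v z)))) \<partial>V) = ennreal (\<psi> g)"
      unfolding \<psi>_def x[symmetric] using iX by (simp add: nn_integral_eq_integral)
    ultimately show ?thesis by blast
  qed
  have \<psi>nn: "0 \<le> \<psi> g" for g unfolding \<psi>_def by (simp add: integral_nonneg_AE)
  have i: "integrable p \<phi>" "integrable p' \<phi>"
    and diff: "\<bar>?E p \<phi> - ?E p' \<phi>\<bar> \<le> max 1 D * norm01 z (\<lambda>g. pmf p g - pmf p' g)"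
    using expectation_diff_le[OF fin mom(1,2) D, of \<phi>] key by blast+
  have \<psi>\<phi>: "\<psi> = (\<lambda>g. \<phi> g + c)" by (simp add: \<phi>_def)
  have eq: "(\<integral>\<^sup>+g. (\<integral>\<^sup>+v. ennreal (dist z (u (g (v z)))) \<partial>V) \<partial>r) = ennreal (?E r \<phi> + c)"
    and nnr: "0 \<le> ?E r \<phi> + c"
    if r: "set_pmf r \<subseteq> set_pmf p \<union> set_pmf p'" "integrable r \<phi>" for r
  proof -
    have "(\<integral>\<^sup>+g. (\<integral>\<^sup>+v. ennreal (dist z (u (g (v z)))) \<partial>V) \<partial>r) = (\<integral>\<^sup>+g. ennreal (\<psi> g) \<partial>r)"
      using key r(1) by (intro nn_integral_cong_AE) (auto simp: AE_measure_pmf_iff)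
    also have "\<dots> = ennreal (?E r \<psi>)"
      using r(2) \<psi>nn by (intro nn_integral_eq_integral) (auto simp: \<psi>\<phi>)
    also have "?E r \<psi> = ?E r \<phi> + c" unfolding \<psi>\<phi> using r(2) by simp
    finally show "(\<integral>\<^sup>+g. (\<integral>\<^sup>+v. ennreal (dist z (u (g (v z)))) \<partial>V) \<partial>r) = ennreal (?E r \<phi> + c)" .
    have "0 \<le> ?E r \<psi>" using \<psi>nn by (simp add: integral_nonneg_AE)
    then show "0 \<le> ?E r \<phi> + c" using r(2) by (simp add: \<psi>\<phi>)
  qed
  have "ennreal (?E p \<phi> + c) \<le> ennreal ((?E p' \<phi> + c) + max 1 D * norm01 z (\<lambda>g. pmf p g - pmf p' g))"
    using diff by (intro ennreal_leI) linarith
  also have "\<dots> = ennreal (?E p' \<phi> + c) + ennreal (max 1 D * norm01 z (\<lambda>g. pmf p g - pmf p' g))"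
    using nnr[of p'] i diff by (intro ennreal_plus) auto
  finally show ?thesis using eq[of p] eq[of p'] i by simp
qed

section \<open>Telescoping over the increments\<close>

lemma norm01_minus_commute:
  "norm01 z (\<lambda>g. pmf p g - pmf p' g) = norm01 z (\<lambda>g. pmf p' g - pmf p g)"
  "finite_norm01 z (\<lambda>g. pmf p g - pmf p' g) = finite_norm01 z (\<lambda>g. pmf p' g - pmf p g)"
  by (simp_all add: norm01_def norm0_def norm1_def finite_norm01_def abs_minus_commute)

lemma moment_conv_pow_finite:
  assumes "\<And>g. g \<in> set_pmf \<mu> \<Longrightarrow> isometry g" "moment z \<mu> < \<infinity>"
  shows "moment z (conv_pow \<mu> n) < \<infinity>"
proof -
  obtain M where M: "0 \<le> M" "moment z \<mu> = ennreal M" using assms(2) by (cases "moment z \<mu>") auto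
  then have "(\<integral>\<^sup>+g. ennreal (dist z (g z)) \<partial>\<mu>) \<le> ennreal M" by (simp add: moment_def)
  from nn_integral_conv_pow_dist[OF assms(1) M(1) this, where n = n] show ?thesis
    unfolding moment_def by (rule le_less_trans) simp_all
qed

lemma telescoped_moment_bound:
  fixes z :: "'a::metric_space"
  assumes iso: "\<And>g. g \<in> set_pmf \<mu> \<union> set_pmf \<mu>' \<Longrightarrow> isometry g"
    and fin: "finite_norm01 z (\<lambda>g. pmf \<mu>' g - pmf \<mu> g)"
    and mom: "moment z \<mu> < \<infinity>" "moment z \<mu>' < \<infinity>" and D: "0 \<le> D"
    and defect: "\<And>x n. (\<integral>\<^sup>+v. ennreal (dist x z + dist z (v z) - dist x (v z)) \<partial>conv_pow \<mu> n) \<le> ennreal D"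
  defines "\<delta> \<equiv> max 1 D * norm01 z (\<lambda>g. pmf \<mu>' g - pmf \<mu> g)"
  shows "\<bar>L_mean z (conv_pow \<mu>' n) - L_mean z (conv_pow \<mu> n)\<bar> \<le> real n * \<delta>"
proof -
  have \<delta>: "0 \<le> \<delta>"
    unfolding \<delta>_def norm01_def norm0_def norm1_def word_norm_def
    by (intro mult_nonneg_nonneg add_nonneg_nonneg infsum_nonneg) auto
  \<comment> \<open>The first \<open>k\<close> increments follow \<open>\<mu>'\<close>, the others
    \<open>\<mu>\<close>. The increment being exchanged is thus always followed by a walk of law
    \<open>\<mu>\<close>, for which the defect is controlled.\<close>
  define a where "a = (\<lambda>k. moment z (bind_pmf (conv_pow \<mu>' k) (\<lambda>u. map_pmf (\<lambda>h. u \<circ> h) (conv_pow \<mu> (n - k)))))"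
  \<comment> \<open>Two inequalities stand in for an absolute value, since subtraction in
    \<open>ennreal\<close> truncates.\<close>
  have step: "a (Suc k) \<le> a k + ennreal \<delta> \<and> a k \<le> a (Suc k) + ennreal \<delta>" if "k < n" for k
  proof -
    define V where "V = conv_pow \<mu> (n - Suc k)"
    let ?I = "\<lambda>u p. \<integral>\<^sup>+g. (\<integral>\<^sup>+v. ennreal (dist z (u (g (v z)))) \<partial>V) \<partial>measure_pmf p"
    have nk: "n - k = Suc (n - Suc k)" using that by simp
    have ak: "a k = (\<integral>\<^sup>+u. ?I u \<mu> \<partial>conv_pow \<mu>' k)"
      unfolding a_def moment_def nk conv_pow_Suc_left V_def by simp
    have aS: "a (Suc k) = (\<integral>\<^sup>+u. ?I u \<mu>' \<partial>conv_pow \<mu>' k)"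
      unfolding a_def moment_def V_def by simp
    have V: "moment z V < \<infinity>" unfolding V_def using moment_conv_pow_finite iso mom by blast
    have isoV: "isometry g" if "g \<in> set_pmf V" for g
      using isometry_conv_pow[of \<mu> g "n - Suc k"] that iso unfolding V_def by blast
    have isou: "isometry u" if "u \<in> set_pmf (conv_pow \<mu>' k)" for u
      using isometry_conv_pow[of \<mu>' u k] that iso by blast
    have 1: "?I u \<mu>' \<le> ?I u \<mu> + ennreal \<delta>" if "u \<in> set_pmf (conv_pow \<mu>' k)" for u
      unfolding \<delta>_def using iso isoV fin mom V D defect isou[OF that]
      by (intro replace_increment_le) (auto simp: V_def)
    have 2: "?I u \<mu> \<le> ?I u \<mu>' + ennreal \<delta>" if "u \<in> set_pmf (conv_pow \<mu>' k)" for u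
      unfolding \<delta>_def norm01_minus_commute(1)[of z \<mu>' \<mu>] using iso isoV fin mom V D defect isou[OF that]
      by (intro replace_increment_le) (auto simp: V_def norm01_minus_commute(2)[of z \<mu> \<mu>'])
    have add: "(\<integral>\<^sup>+u. f u + ennreal \<delta> \<partial>conv_pow \<mu>' k) = (\<integral>\<^sup>+u. f u \<partial>conv_pow \<mu>' k) + ennreal \<delta>" for f
      by (simp add: nn_integral_add measure_pmf.emeasure_space_1)
    show ?thesis unfolding ak aS add[symmetric]
      using 1 2 by (intro conjI nn_integral_mono_AE) (auto simp: AE_measure_pmf_iff)
  qed
  have tele: "a k \<le> a 0 + ennreal (real k * \<delta>) \<and> a 0 \<le> a k + ennreal (real k * \<delta>)" if "k \<le> n" for k
    using that
  proof (induction k)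
    case (Suc k)
    have e: "ennreal (real (Suc k) * \<delta>) = ennreal (real k * \<delta>) + ennreal \<delta>"
      using \<delta> by (simp add: ennreal_plus[symmetric] algebra_simps del: ennreal_plus)
    have IH: "a k \<le> a 0 + ennreal (real k * \<delta>)" "a 0 \<le> a k + ennreal (real k * \<delta>)" using Suc by auto
    have st: "a (Suc k) \<le> a k + ennreal \<delta>" "a k \<le> a (Suc k) + ennreal \<delta>" using step[of k] Suc.prems by auto
    have "a (Suc k) \<le> (a 0 + ennreal (real k * \<delta>)) + ennreal \<delta>"
      using st(1) add_right_mono[OF IH(1)] by (rule order_trans)
    moreover have "a 0 \<le> (a (Suc k) + ennreal \<delta>) + ennreal (real k * \<delta>)"
      using IH(2) add_right_mono[OF st(2)] by (rule order_trans)
    ultimately show ?case unfolding e by (simp add: ac_simps)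
  qed simp
  have a0: "a 0 = moment z (conv_pow \<mu> n)" by (simp add: a_def bind_return_pmf moment_def)
  have an: "a n = moment z (conv_pow \<mu>' n)" by (simp add: a_def bind_return_pmf' moment_def)
  have L: "moment z (conv_pow \<mu> n) = ennreal (L_mean z (conv_pow \<mu> n))"
    "moment z (conv_pow \<mu>' n) = ennreal (L_mean z (conv_pow \<mu>' n))"
    using ennreal_L_mean moment_conv_pow_finite iso mom by (metis UnI1, metis UnI2)
  have "ennreal (L_mean z (conv_pow \<mu>' n)) \<le> ennreal (L_mean z (conv_pow \<mu> n) + real n * \<delta>)"
    "ennreal (L_mean z (conv_pow \<mu> n)) \<le> ennreal (L_mean z (conv_pow \<mu>' n) + real n * \<delta>)"
    using tele[of n] \<delta> unfolding a0 an L by (simp_all add: L_mean_nonneg)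
  then have "L_mean z (conv_pow \<mu>' n) \<le> L_mean z (conv_pow \<mu> n) + real n * \<delta>"
    "L_mean z (conv_pow \<mu> n) \<le> L_mean z (conv_pow \<mu>' n) + real n * \<delta>"
    using \<delta> L_mean_nonneg[of z] by (simp_all add: ennreal_le_iff del: ennreal_plus)
  then show ?thesis by linarith
qed

text \<open>The triangle inequality makes the mean displacement subadditive in \<open>n\<close>, so
  the \<open>lim\<close> in \<open>escape_rate\<close> is an actual limit.\<close>

lemma escape_rate_limit:
  fixes z :: "'a::metric_space"
  assumes iso: "\<And>g. g \<in> set_pmf \<mu> \<Longrightarrow> isometry g" and mom: "moment z \<mu> < \<infinity>"
  shows "(\<lambda>n. L_mean z (conv_pow \<mu> n) / real n) \<longlonglongrightarrow> escape_rate z \<mu>"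
proof -
  have fin: "moment z (conv_pow \<mu> n) < \<infinity>" for n using moment_conv_pow_finite iso mom by blast
  have "L_mean z (conv_pow \<mu> (m + n)) \<le> L_mean z (conv_pow \<mu> m) + L_mean z (conv_pow \<mu> n)" for m n
  proof -
    have "moment z (conv_pow \<mu> (m + n)) = (\<integral>\<^sup>+g. (\<integral>\<^sup>+h. ennreal (dist z (g (h z))) \<partial>conv_pow \<mu> n) \<partial>conv_pow \<mu> m)"
      unfolding moment_def conv_pow_add by simp
    also have "\<dots> \<le> (\<integral>\<^sup>+g. (\<integral>\<^sup>+h. ennreal (dist z (g z)) + ennreal (dist z (h z)) \<partial>conv_pow \<mu> n) \<partial>conv_pow \<mu> m)"
    proof (rule nn_integral_mono_AE, unfold AE_measure_pmf_iff, intro ballI nn_integral_mono)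
      fix g h assume "g \<in> set_pmf (conv_pow \<mu> m)"
      then have "isometry g" using isometry_conv_pow iso by blast
      then have "dist z (g (h z)) \<le> dist z (g z) + dist z (h z)"
        using dist_triangle[of z "g (h z)" "g z"] by (simp add: isometry_dist)
      then show "ennreal (dist z (g (h z))) \<le> ennreal (dist z (g z)) + ennreal (dist z (h z))"
        by (simp add: ennreal_plus[symmetric] ennreal_leI del: ennreal_plus)
    qed
    also have "\<dots> = moment z (conv_pow \<mu> m) + moment z (conv_pow \<mu> n)"
      by (simp add: nn_integral_add measure_pmf.emeasure_space_1 moment_def)
    finally have "ennreal (L_mean z (conv_pow \<mu> (m + n))) \<le> ennreal (L_mean z (conv_pow \<mu> m) + L_mean z (conv_pow \<mu> n))"
      unfolding ennreal_L_mean[OF fin, symmetric] by (simp add: L_mean_nonneg)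
    then show ?thesis by (subst (asm) ennreal_le_iff) (simp_all add: L_mean_nonneg)
  qed
  then have "convergent (\<lambda>n. L_mean z (conv_pow \<mu> n) / real n)"
    using L_mean_nonneg by (intro subadditive_convergent)
  then show ?thesis unfolding escape_rate_def by (simp add: convergent_LIMSEQ_iff)
qed

theorem theorem1p2:
  fixes bp :: "'a::metric_space" and G :: "('a \<Rightarrow> 'a) set" and \<mu> :: "('a \<Rightarrow> 'a) pmf"
  assumes "geodesic_space TYPE('a)"
    and "isometry_group G" and "countable G"
    and "\<exists>g\<in>G. \<exists>h\<in>G. independent bp g h"
    and "set_pmf \<mu> \<subseteq> G" and "non_elementary bp \<mu>" and "finite_first_moment bp \<mu>"
  shows "\<exists>C>0. \<exists>\<epsilon>>0. \<forall>\<mu>'::('a \<Rightarrow> 'a) pmf. set_pmf \<mu>' \<subseteq> G \<longrightarrow>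
           finite_norm01 bp (\<lambda>g. pmf \<mu>' g - pmf \<mu> g) \<longrightarrow>
           norm01 bp (\<lambda>g. pmf \<mu>' g - pmf \<mu> g) < \<epsilon> \<longrightarrow>
           \<bar>escape_rate bp \<mu>' - escape_rate bp \<mu>\<bar> \<le> C * norm01 bp (\<lambda>g. pmf \<mu>' g - pmf \<mu> g)"
proof -
  have iso: "isometry g" if "g \<in> G" for g using assms(2) that by (simp add: isometry_group_def)
  have iso_\<mu>: "isometry g" if "g \<in> set_pmf \<mu>" for g using assms(5) iso that by blast
  have mom: "moment bp \<mu> < \<infinity>" using assms(7) by (rule moment_finite)
  then obtain M where M: "0 \<le> M" "moment bp \<mu> = ennreal M" by (cases "moment bp \<mu>") auto
  then have "(\<integral>\<^sup>+g. ennreal (dist bp (g bp)) \<partial>\<mu>) \<le> ennreal M" by (simp add: moment_def)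
  from bounded_expected_defect[OF assms(1) iso_\<mu> assms(6) M(1) this]
  obtain D where D: "0 \<le> D"
    "\<And>x n. (\<integral>\<^sup>+v. ennreal (dist x bp + dist bp (v bp) - dist x (v bp)) \<partial>conv_pow \<mu> n) \<le> ennreal D"
    by blast
  have "\<bar>escape_rate bp \<mu>' - escape_rate bp \<mu>\<bar> \<le> max 1 D * norm01 bp (\<lambda>g. pmf \<mu>' g - pmf \<mu> g)"
    if G: "set_pmf \<mu>' \<subseteq> G" and fin: "finite_norm01 bp (\<lambda>g. pmf \<mu>' g - pmf \<mu> g)" for \<mu>'
  proof -
    let ?\<delta> = "max 1 D * norm01 bp (\<lambda>g. pmf \<mu>' g - pmf \<mu> g)"
    have iso': "isometry g" if "g \<in> set_pmf \<mu>'" for g using G iso that by blast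
    \<comment> \<open>Dominates the first moment of \<open>\<mu>'\<close>, because
      \<open>pmf \<mu>' g\<close> is at most \<open>pmf \<mu> g\<close> plus the absolute
      difference.\<close>
    have "(\<lambda>g. word_norm bp g * pmf \<mu> g + word_norm bp g * \<bar>pmf \<mu>' g - pmf \<mu> g\<bar>) summable_on UNIV"
      using assms(7) fin by (intro summable_on_add) (auto simp: finite_first_moment_def finite_norm01_def)
    then have "(\<lambda>g. word_norm bp g * pmf \<mu>' g) summable_on UNIV"
    proof (rule summable_on_comparison_test)
      fix g :: "'a \<Rightarrow> 'a"
      have "word_norm bp g * pmf \<mu>' g \<le> word_norm bp g * (pmf \<mu> g + \<bar>pmf \<mu>' g - pmf \<mu> g\<bar>)"
        by (rule mult_left_mono) (auto simp: word_norm_def)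
      then show "word_norm bp g * pmf \<mu>' g \<le> word_norm bp g * pmf \<mu> g + word_norm bp g * \<bar>pmf \<mu>' g - pmf \<mu> g\<bar>"
        by (simp add: distrib_left)
    qed (simp add: word_norm_def)
    then have mom': "moment bp \<mu>' < \<infinity>" by (intro moment_finite) (simp only: finite_first_moment_def)
    have "(\<lambda>n. \<bar>L_mean bp (conv_pow \<mu>' n) / real n - L_mean bp (conv_pow \<mu> n) / real n\<bar>)
        \<longlonglongrightarrow> \<bar>escape_rate bp \<mu>' - escape_rate bp \<mu>\<bar>"
      by (intro tendsto_rabs tendsto_diff escape_rate_limit iso_\<mu> iso' mom mom')
    moreover have "\<bar>L_mean bp (conv_pow \<mu>' n) / real n - L_mean bp (conv_pow \<mu> n) / real n\<bar> \<le> ?\<delta>" if "1 \<le> n" for n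
    proof -
      have "\<bar>L_mean bp (conv_pow \<mu>' n) - L_mean bp (conv_pow \<mu> n)\<bar> \<le> real n * ?\<delta>"
        using iso_\<mu> iso' fin mom mom' D by (intro telescoped_moment_bound) auto
      then have "\<bar>L_mean bp (conv_pow \<mu>' n) - L_mean bp (conv_pow \<mu> n)\<bar> / real n \<le> ?\<delta>"
        using that by (simp add: divide_le_eq mult.commute)
      then show ?thesis by (simp add: diff_divide_distrib[symmetric] abs_divide)
    qed
    ultimately show ?thesis by (intro LIMSEQ_le_const2) blast+
  qed
  then show ?thesis by (intro exI[of _ "max 1 D"] exI[of _ 1] conjI) (auto simp: zero_less_one)
qed

end
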